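(* Let $\psi\in\Psi$ and, for each $n\in\mathbb N$ (large enough that the expression is defined), let $$b_n=\left\lfloor\frac{\log\psi(\lfloor\log n\rfloor)-\log\log n}{\log 2}\right\rfloor.$$ If $\lim_{n\to\infty} b_n/(\log n)^{1/4}=0$, then $$\lim_{n\to\infty}\frac{S_n^{b_n}}{n\log n}=1\quad\lambda\text{-almost surely}.$$
   Context: Let $\lambda$ be Lebesgue measure on $[0,1)$ and $\tau:[0,1)\to[0,1)$ the doubling map $\tau(x)=2x \bmod 1$ (so $\lambda$ is $\tau$-invariant). Let $\chi:[0,1)\to\mathbb N\cup\{\infty\}$, $\chi(x)=\lfloor 1/x\rfloor$ (with $\chi(0)=\infty$). For $n\in\mathbb N$ set $a_n=\chi\circ\tau^{n-1}$ and $S_n=\sum_{k=1}^n a_k$. For $n\in\mathbb N$ and $x\in[0,1)$ let $\pi$ be a permutation of $\{1,\dots,n\}$ with $a_{\pi(1)}(x)\ge a_{\pi(2)}(x)\ge\dots\ge a_{\pi(n)}(x)$, and for $b\in\mathbb N$ define the trimmed sum $S_n^b=\sum_{k=b+1}^n a_{\pi(k)}$ (the sum with the $b$ largest terms removed). Let $\Psi=\{u:\mathbb N\to\mathbb R_{>0}: \sum_{n\ge1}1/u(n)<\infty\}$. Logarithms are natural. *)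

theory Defs
  imports "HOL-Analysis.Analysis"
begin

definition tau :: "real \<Rightarrow> real" where
  "tau x = frac (2 * x)"

definition chi :: "real \<Rightarrow> ereal" where
  "chi x = (if x = 0 then \<infinity> else ereal (real_of_int \<lfloor>1 / x\<rfloor>))"

definition a :: "nat \<Rightarrow> real \<Rightarrow> ereal" where
  "a k x = chi ((tau ^^ (k - 1)) x)"

definition trimmed_sum :: "nat \<Rightarrow> nat \<Rightarrow> real \<Rightarrow> ereal" where
  "trimmed_sum n b x = sum_list (drop b (rev (sort (map (\<lambda>k. a k x) [1..<Suc n]))))"

text \<open>The class Psi (functions on N = {1,2,...}; the value at 0 is irrelevant).\<close>
definition Psi :: "(nat \<Rightarrow> real) set" where
  "Psi = {u. (\<forall>n\<ge>1. u n > 0) \<and> summable (\<lambda>n. 1 / u (Suc n))}"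

definition bseq :: "(nat \<Rightarrow> real) \<Rightarrow> nat \<Rightarrow> int" where
  "bseq \<psi> n = \<lfloor>(ln (\<psi> (nat \<lfloor>ln (real n)\<rfloor>)) - ln (ln (real n))) / ln 2\<rfloor>"

end

(* The orbit is close to 0 in runs along which the point doubles at each step, so a large term
   brings the terms half, a quarter, ... as large with it, and removing b terms divides the
   contribution of one such run by 2^b.

   Cap 1/x at the level M(n) = n (ln n)^(3/4).  Correlations of the capped function along the
   doubling map decay geometrically, so the variance of its Birkhoff sum is O(n M(n)), and along a
   subexponentially growing sequence of times Chebyshev's bound O((ln n)^(-5/4)) is summable; by
   monotonicity the capped sums are asymptotic to n ln n.  Two different runs above M(n) before time n
   have probability at most (n / M(n))^2 = (ln n)^(-3/2), so eventually there is at most one.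
   By summability of 1/psi, all terms stay below (n / m) psi(ln n) for every fixed m, and
   2^(-b_n) is at most 2 ln n / psi(ln n), so after trimming the run contributes at most 4 n ln n / m.
   Trimming lowers the capped sum by at most b_n M(n) = o(n ln n), which uses b_n = o((ln n)^(1/4)). *)

theory Submission
  imports Defs "HOL-Real_Asymp.Real_Asymp"
begin

section \<open>The doubling map and Lebesgue measure\<close>

abbreviation unif :: "real measure" where
  "unif \<equiv> restrict_space lborel {0..<1}"

lemma nn_integral_unif:
  "(\<integral>\<^sup>+x. f x \<partial>unif) = (\<integral>\<^sup>+x. f x * indicator {0..<1} x \<partial>lborel)"
  by (simp add: nn_integral_restrict_space)

lemma space_unif [simp]: "space unif = {0..<1}"
  by (simp add: space_restrict_space)

lemma emeasure_unif_space: "emeasure unif {0..<1} = 1"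
  by (simp add: emeasure_restrict_space)

lemma finite_measure_unif: "finite_measure unif"
  by (rule finite_measureI) (simp add: emeasure_unif_space)

lemma borel_measurable_unif:
  "f \<in> borel_measurable borel \<Longrightarrow> f \<in> borel_measurable unif"
  by (simp add: measurable_restrict_space1)

text \<open>Adjacent half-open slices telescope. For \<open>n = N\<close> this yields the partition
  of the unit interval used to cut integrals.\<close>

lemma sum_indicator_slices:
  fixes N :: nat and x :: real
  assumes "N > 0"
  shows "(\<Sum>i<n. indicator {real i / N..<real (Suc i) / N} x) = (indicator {0..<real n / N} x :: ennreal)"
proof (induction n)
  case (Suc n)
  have split: "indicator {0..<p} x + indicator {p..<q} x = (indicator {0..<q} x :: ennreal)"
    if "0 \<le> p" "p \<le> q" for p q
    using that by (auto simp: indicator_def)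
  show ?case
    unfolding sum.lessThan_Suc Suc.IH by (intro split divide_right_mono) auto
qed simp

text \<open>Each slice is the affine image of the unit interval under an inverse branch, with
  Jacobian \<open>1 / N\<close>. For \<open>N = 2 ^ k\<close> these are the inverse branches of
  \<open>tau ^^ k\<close>, so this identity takes the place of the transfer operator.\<close>

lemma nn_integral_unif_slices:
  fixes N :: nat
  assumes [measurable]: "F \<in> borel_measurable borel" and N: "N > 0"
  shows "(\<integral>\<^sup>+x. F x \<partial>unif) = (\<Sum>i<N. ennreal (1 / N) * (\<integral>\<^sup>+y. F ((real i + y) / N) \<partial>unif))"
proof -
  have slice: "ennreal (1 / N) * (\<integral>\<^sup>+y. F ((real i + y) / N) \<partial>unif) =
      (\<integral>\<^sup>+x. F x * indicator {real i / N..<real (Suc i) / N} x \<partial>lborel)" for i :: nat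
  proof -
    have "(\<integral>\<^sup>+x. F x * indicator {real i / N..<real (Suc i) / N} x \<partial>lborel) =
      ennreal \<bar>1 / N\<bar> * (\<integral>\<^sup>+y. F (real i / N + 1 / N * y) *
          indicator {real i / N..<real (Suc i) / N} (real i / N + 1 / N * y) \<partial>lborel)"
      using N by (intro nn_integral_real_affine) auto
    also have "(\<lambda>y. F (real i / N + 1 / N * y) *
          indicator {real i / N..<real (Suc i) / N} (real i / N + 1 / N * y)) =
        (\<lambda>y. F ((real i + y) / N) * indicator {0..<1} y)"
      using N by (auto simp: fun_eq_iff indicator_def field_simps)
    finally show ?thesis by (simp add: nn_integral_unif)
  qed
  have "(\<Sum>i<N. ennreal (1 / N) * (\<integral>\<^sup>+y. F ((real i + y) / N) \<partial>unif)) =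
      (\<integral>\<^sup>+x. (\<Sum>i<N. F x * indicator {real i / N..<real (Suc i) / N} x) \<partial>lborel)"
    unfolding slice by (rule nn_integral_sum[symmetric]) auto
  also have "\<dots> = (\<integral>\<^sup>+x. F x * indicator {0..<1} x \<partial>lborel)"
    using N by (simp only: sum_distrib_left[symmetric] sum_indicator_slices) simp
  finally show ?thesis by (simp add: nn_integral_unif)
qed

section \<open>Iterates of the doubling map and their inverse branches\<close>

lemma frac_double_frac: "frac (2 * frac z) = frac (2 * z)" for z :: real
proof -
  have "2 * z = 2 * frac z + of_int (2 * \<lfloor>z\<rfloor>)" by (simp add: frac_def)
  then show ?thesis by (metis frac_add_of_int_right)
qed

lemma tau_funpow:
  assumes "x \<in> {0..<1}"
  shows "(tau ^^ k) x = frac (2 ^ k * x)"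
proof (induction k)
  case 0
  then show ?case using assms by (simp add: frac_eq)
next
  case (Suc k)
  then show ?case by (simp add: tau_def frac_double_frac mult.assoc)
qed

lemma tau_funpow_range: "x \<in> {0..<1} \<Longrightarrow> (tau ^^ k) x \<in> {0..<1}"
  by (simp add: tau_funpow frac_lt_1)

lemma tau_funpow_slice:
  assumes "y \<in> {0..<1}" "i < 2 ^ k"
  shows "(tau ^^ k) ((real i + y) / 2 ^ k) = y"
proof -
  have "real i + 1 \<le> 2 ^ k"
    using assms(2) by (metis Suc_leI of_nat_Suc of_nat_le_iff of_nat_numeral of_nat_power add.commute)
  then have "(real i + y) / 2 ^ k \<in> {0..<1}" using assms by auto
  then have "(tau ^^ k) ((real i + y) / 2 ^ k) = frac (y + of_int (int i))"
    by (simp add: tau_funpow add.commute)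
  moreover have "frac (y + of_int (int i)) = y"
    using assms(1) by (simp only: frac_add_of_int_right) (simp add: frac_eq)
  ultimately show ?thesis by simp
qed

lemma tau_funpow_measurable [measurable]: "(tau ^^ k) \<in> borel_measurable borel"
proof (induction k)
  case (Suc k)
  have [measurable]: "tau \<in> borel_measurable borel" unfolding tau_def frac_def by measurable
  from Suc have [measurable]: "(tau ^^ k) \<in> borel_measurable borel" .
  show ?case unfolding funpow.simps by measurable
qed simp

section \<open>Invariance and decorrelation\<close>

lemma nn_integral_unif_correlation:
  assumes [measurable]: "\<phi> \<in> borel_measurable borel" "h \<in> borel_measurable borel"
  shows "(\<integral>\<^sup>+x. \<phi> x * h ((tau ^^ k) x) \<partial>unif) =
    (\<Sum>i<2 ^ k. ennreal (1 / 2 ^ k) * (\<integral>\<^sup>+y. \<phi> ((real i + y) / 2 ^ k) * h y \<partial>unif))"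
proof -
  have "(\<integral>\<^sup>+x. \<phi> x * h ((tau ^^ k) x) \<partial>unif) =
    (\<Sum>i<2 ^ k. ennreal (1 / 2 ^ k) * (\<integral>\<^sup>+y. \<phi> ((real i + y) / 2 ^ k) * h ((tau ^^ k) ((real i + y) / 2 ^ k)) \<partial>unif))"
    using nn_integral_unif_slices[of "\<lambda>x. \<phi> x * h ((tau ^^ k) x)" "2 ^ k"] by simp
  \<comment> \<open>On each slice \<open>tau ^^ k\<close> undoes the rescaling, so \<open>h\<close>
    sees the new variable itself and only \<open>\<phi>\<close> still depends on the slice.\<close>
  also have "\<dots> = (\<Sum>i<2 ^ k. ennreal (1 / 2 ^ k) * (\<integral>\<^sup>+y. \<phi> ((real i + y) / 2 ^ k) * h y \<partial>unif))"
    by (intro sum.cong refl arg_cong[where f = "\<lambda>t. _ * t"] nn_integral_cong) (simp add: tau_funpow_slice)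
  finally show ?thesis .
qed

lemma nn_integral_unif_tau:
  assumes [measurable]: "h \<in> borel_measurable borel"
  shows "(\<integral>\<^sup>+x. h ((tau ^^ k) x) \<partial>unif) = (\<integral>\<^sup>+x. h x \<partial>unif)"
proof -
  have "(\<integral>\<^sup>+x. h ((tau ^^ k) x) \<partial>unif) =
      (\<Sum>i<(2::nat) ^ k. ennreal (1 / 2 ^ k) * (\<integral>\<^sup>+y. h y \<partial>unif))"
    using nn_integral_unif_correlation[of "\<lambda>_. 1" h k] by simp
  also have "\<dots> = (\<Sum>i<(2::nat) ^ k. ennreal (1 / 2 ^ k)) * (\<integral>\<^sup>+y. h y \<partial>unif)"
    by (rule sum_distrib_right[symmetric])
  also have "(\<Sum>i<(2::nat) ^ k. ennreal (1 / 2 ^ k)) = 1"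
    by (subst sum_ennreal) auto
  finally show ?thesis by simp
qed

text \<open>Every slice but the first is dominated by the whole of its left neighbour.\<close>

lemma sum_slices_decorrelation:
  assumes [measurable]: "\<phi> \<in> borel_measurable borel" "h \<in> borel_measurable borel"
    and anti: "\<And>x y. 0 \<le> x \<Longrightarrow> x \<le> y \<Longrightarrow> y < 1 \<Longrightarrow> \<phi> y \<le> \<phi> x"
    and N: "N > 0"
  shows "(\<Sum>i\<in>{1..<N}. ennreal (1 / N) * (\<integral>\<^sup>+y. \<phi> ((real i + y) / N) * h y \<partial>unif))
    \<le> (\<integral>\<^sup>+x. \<phi> x \<partial>unif) * (\<integral>\<^sup>+x. h x \<partial>unif)"
proof -
  have one: "(\<integral>\<^sup>+y. \<phi> ((real i + y) / N) * h y \<partial>unif)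
      \<le> (\<integral>\<^sup>+z. \<phi> ((real (i - 1) + z) / N) \<partial>unif) * (\<integral>\<^sup>+y. h y \<partial>unif)"
    if i: "i \<in> {1..<N}" for i
  proof -
    have "\<phi> ((real i + y) / N) \<le> (\<integral>\<^sup>+z. \<phi> ((real (i - 1) + z) / N) \<partial>unif)"
      if y: "y \<in> {0..<1}" for y
    proof -
      have "\<phi> ((real i + y) / N) = (\<integral>\<^sup>+z. \<phi> ((real i + y) / N) \<partial>unif)"
        by (simp add: emeasure_unif_space)
      also have "\<dots> \<le> (\<integral>\<^sup>+z. \<phi> ((real (i - 1) + z) / N) \<partial>unif)"
      proof (rule nn_integral_mono)
        fix z assume "z \<in> space unif"
        then have z: "0 \<le> z" "z < 1" by auto
        have iN: "real i + 1 \<le> real N" "1 \<le> real i" "real (i - 1) = real i - 1" using i by auto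
        show "\<phi> ((real i + y) / N) \<le> \<phi> ((real (i - 1) + z) / N)"
        proof (rule anti)
          show "(real i + y) / N < 1"
            using iN y N by (simp add: field_simps)
          show "(real (i - 1) + z) / N \<le> (real i + y) / N"
            using iN y z by (intro divide_right_mono) auto
        qed (use z in auto)
      qed
      finally show ?thesis .
    qed
    then have "(\<integral>\<^sup>+y. \<phi> ((real i + y) / N) * h y \<partial>unif)
        \<le> (\<integral>\<^sup>+y. (\<integral>\<^sup>+z. \<phi> ((real (i - 1) + z) / N) \<partial>unif) * h y \<partial>unif)"
      by (intro nn_integral_mono mult_right_mono) auto
    also have "\<dots> = (\<integral>\<^sup>+z. \<phi> ((real (i - 1) + z) / N) \<partial>unif) * (\<integral>\<^sup>+y. h y \<partial>unif)"
      by (intro nn_integral_cmult borel_measurable_unif) simp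
    finally show ?thesis .
  qed
  have "(\<Sum>i\<in>{1..<N}. ennreal (1 / N) * (\<integral>\<^sup>+y. \<phi> ((real i + y) / N) * h y \<partial>unif))
     \<le> (\<Sum>i\<in>{1..<N}. ennreal (1 / N) * ((\<integral>\<^sup>+z. \<phi> ((real (i - 1) + z) / N) \<partial>unif) * (\<integral>\<^sup>+y. h y \<partial>unif)))"
    by (intro sum_mono mult_left_mono one) auto
  also have "\<dots> = (\<Sum>i\<in>{1..<N}. ennreal (1 / N) * (\<integral>\<^sup>+z. \<phi> ((real (i - 1) + z) / N) \<partial>unif)) * (\<integral>\<^sup>+y. h y \<partial>unif)"
    by (simp add: sum_distrib_right mult.assoc)
  also have "(\<Sum>i\<in>{1..<N}. ennreal (1 / N) * (\<integral>\<^sup>+z. \<phi> ((real (i - 1) + z) / N) \<partial>unif)) =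
     (\<Sum>i<N - 1. ennreal (1 / N) * (\<integral>\<^sup>+z. \<phi> ((real i + z) / N) \<partial>unif))"
    by (rule sum.reindex_bij_witness[of _ Suc "\<lambda>i. i - 1"]) auto
  also have "\<dots> \<le> (\<Sum>i<N. ennreal (1 / N) * (\<integral>\<^sup>+z. \<phi> ((real i + z) / N) \<partial>unif))"
    by (intro sum_mono2) auto
  also have "\<dots> = (\<integral>\<^sup>+x. \<phi> x \<partial>unif)"
    using N by (simp add: nn_integral_unif_slices)
  finally show ?thesis by (simp add: mult_right_mono)
qed

text \<open>The slice at 0 has no left neighbour to dominate it, so it stays as an error term. The
  remaining slices together cost no more than independence would.\<close>

lemma nn_integral_unif_decorrelation:
  assumes [measurable]: "\<phi> \<in> borel_measurable borel" "h \<in> borel_measurable borel"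
    and anti: "\<And>x y. 0 \<le> x \<Longrightarrow> x \<le> y \<Longrightarrow> y < 1 \<Longrightarrow> \<phi> y \<le> \<phi> x"
  shows "(\<integral>\<^sup>+x. \<phi> x * h ((tau ^^ k) x) \<partial>unif) \<le>
      ennreal (1 / 2 ^ k) * (\<integral>\<^sup>+y. \<phi> (y / 2 ^ k) * h y \<partial>unif)
      + (\<integral>\<^sup>+x. \<phi> x \<partial>unif) * (\<integral>\<^sup>+x. h x \<partial>unif)"
proof -
  have eq: "{..<(2::nat) ^ k} = insert 0 {1..<2 ^ k}" by auto
  show ?thesis
    unfolding nn_integral_unif_correlation[OF assms(1,2)] eq
    using sum_slices_decorrelation[OF assms, of "2 ^ k"] by (simp add: add_left_mono)
qed

text \<open>The extra indicator vanishes exactly on the slice at 0, the only one that spoils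
  independence, so no error term is left.\<close>

lemma nn_integral_unif_decorrelation_far:
  assumes [measurable]: "\<phi> \<in> borel_measurable borel" "h \<in> borel_measurable borel"
    and anti: "\<And>x y. 0 \<le> x \<Longrightarrow> x \<le> y \<Longrightarrow> y < 1 \<Longrightarrow> \<phi> y \<le> \<phi> x"
  shows "(\<integral>\<^sup>+x. \<phi> x * indicator {1..} (2 ^ k * x) * h ((tau ^^ k) x) \<partial>unif) \<le>
      (\<integral>\<^sup>+x. \<phi> x \<partial>unif) * (\<integral>\<^sup>+x. h x \<partial>unif)"
proof -
  have eq: "{..<(2::nat) ^ k} = insert 0 {1..<2 ^ k}" by auto
  have "(\<integral>\<^sup>+x. \<phi> x * indicator {1..} (2 ^ k * x) * h ((tau ^^ k) x) \<partial>unif) =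
     (\<Sum>i<2 ^ k. ennreal (1 / 2 ^ k) * (\<integral>\<^sup>+y. \<phi> ((real i + y) / 2 ^ k) * indicator {1..} (real i + y) * h y \<partial>unif))"
    by (subst nn_integral_unif_correlation) auto
  also have "\<dots> = (\<Sum>i\<in>{1..<2^k}. ennreal (1 / 2 ^ k) * (\<integral>\<^sup>+y. \<phi> ((real i + y) / 2 ^ k) * indicator {1..} (real i + y) * h y \<partial>unif))"
  proof -
    have "(\<integral>\<^sup>+y. \<phi> (y / 2 ^ k) * indicator {1..} y * h y \<partial>unif) = (\<integral>\<^sup>+y. 0 \<partial>unif)"
      by (intro nn_integral_cong) auto
    then show ?thesis unfolding eq by simp
  qed
  also have "\<dots> \<le> (\<Sum>i\<in>{1..<2^k}. ennreal (1 / 2 ^ k) * (\<integral>\<^sup>+y. \<phi> ((real i + y) / 2 ^ k) * h y \<partial>unif))"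
    by (intro sum_mono mult_left_mono nn_integral_mono) (auto simp: indicator_def)
  also have "\<dots> \<le> (\<integral>\<^sup>+x. \<phi> x \<partial>unif) * (\<integral>\<^sup>+x. h x \<partial>unif)"
    using sum_slices_decorrelation[OF assms, of "2 ^ k"] by simp
  finally show ?thesis .
qed

section \<open>Second moments of capped sums\<close>

text \<open>For positive \<open>x\<close> and \<open>M\<close> this is the minimum of
  \<open>1 / x\<close> and \<open>M\<close>. Capping in the denominator keeps the function bounded
  and antitone on the whole line, including \<open>x = 0\<close>.\<close>

definition cap :: "real \<Rightarrow> real \<Rightarrow> real" where
  "cap M x = 1 / max x (1 / M)"

lemma cap_measurable [measurable]: "cap M \<in> borel_measurable borel"
  unfolding cap_def by measurable

lemma cap_nonneg: "M > 0 \<Longrightarrow> 0 \<le> cap M x"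
  by (simp add: cap_def le_max_iff_disj)

lemma cap_le: "cap M x \<le> M" if "M > 0"
proof -
  have "1 / max x (1 / M) \<le> 1 / (1 / M)"
    using that by (intro divide_left_mono mult_pos_pos) (auto simp: less_max_iff_disj)
  then show ?thesis by (simp add: cap_def)
qed

lemma cap_antimono: "M > 0 \<Longrightarrow> x \<le> y \<Longrightarrow> cap M y \<le> cap M x"
  unfolding cap_def by (intro divide_left_mono mult_pos_pos) (auto simp: less_max_iff_disj)

lemma cap_mono: "0 < M \<Longrightarrow> M \<le> M' \<Longrightarrow> cap M x \<le> cap M' x"
  unfolding cap_def
  by (intro divide_left_mono mult_pos_pos max.mono) (auto simp: less_max_iff_disj frac_le)

lemma cap_eq_min: "M > 0 \<Longrightarrow> x > 0 \<Longrightarrow> cap M x = min (1 / x) M"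
  by (auto simp: cap_def max_def min_def field_simps)

text \<open>Self-similarity of \<open>1 / x\<close>: the rescaled cap on the slice at 0 is again a
  cap, at a lower level. This makes the error term of the decorrelation bound computable.\<close>

lemma cap_scale: "M > 0 \<Longrightarrow> 1 / 2 ^ k * cap M (y / 2 ^ k) = cap (M / 2 ^ k) y"
  by (auto simp: cap_def max_def field_simps)

lemma nn_integral_cap:
  assumes "M \<ge> 1"
  shows "(\<integral>\<^sup>+x. ennreal (cap M x) \<partial>unif) = ennreal (1 + ln M)"
proof -
  have M: "0 < M" "1 / M \<le> 1" using assms by auto
  have low: "(\<integral>\<^sup>+x. ennreal M * indicator {0..1/M} x \<partial>lborel) = ennreal (M * (1 / M) - M * 0)"
    using M by (intro nn_integral_FTC_Icc) (auto intro!: derivative_eq_intros)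
  have high: "(\<integral>\<^sup>+x. ennreal (1 / x) * indicator {1/M..1} x \<partial>lborel) = ennreal (ln 1 - ln (1 / M))"
  proof (rule nn_integral_FTC_Icc[where F = ln])
    fix x assume "x \<in> {1 / M..1}"
    then have "1 / M \<le> x" by simp
    moreover have "0 < 1 / M" using M by simp
    ultimately have "0 < x" by linarith
    then show "(ln has_real_derivative 1 / x) (at x)" "0 \<le> 1 / x"
      by (auto intro!: derivative_eq_intros)
  qed (use M in auto)
  have "(\<integral>\<^sup>+x. ennreal (cap M x) * indicator {0..<1} x \<partial>lborel) =
     (\<integral>\<^sup>+x. ennreal M * indicator {0..1/M} x + ennreal (1 / x) * indicator {1/M..1} x \<partial>lborel)"
  \<comment> \<open>The closed intervals required by the fundamental theorem share the point
    \<open>1 / M\<close> and include 1, so the two integrands agree only almost everywhere.\<close>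
  proof (intro nn_integral_cong_AE)
    have "AE x in lborel. x \<noteq> 1 \<and> x \<noteq> 1 / M"
      by (intro AE_conjI AE_lborel_singleton)
    then show "AE x in lborel. ennreal (cap M x) * indicator {0..<1} x =
       ennreal M * indicator {0..1/M} x + ennreal (1 / x) * indicator {1/M..1} x"
    proof eventually_elim
      case (elim x)
      define p where "p = 1 / M"
      have p: "0 < p" "p \<le> 1" "M = 1 / p" using M by (auto simp: p_def)
      then show ?case using elim by (auto simp: indicator_def cap_def max_def p_def[symmetric])
    qed
  qed
  also have "\<dots> = ennreal 1 + ennreal (ln M)"
    using low high M by (simp add: nn_integral_add ln_div)
  also have "\<dots> = ennreal (1 + ln M)"
    using assms by (subst ennreal_plus) auto
  finally show ?thesis by (simp add: nn_integral_unif)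
qed

text \<open>For \<open>M \<ge> 1\<close> the plateau contributes \<open>M\<close> and the tail
  \<open>M - 1\<close>. Levels below 1 are covered too, because the bound is applied at
  \<open>M / 2 ^ k\<close>.\<close>

lemma nn_integral_cap_square:
  assumes "M > 0"
  shows "(\<integral>\<^sup>+x. ennreal ((cap M x)\<^sup>2) \<partial>unif) \<le> ennreal (2 * M)"
proof (cases "M \<ge> 1")
  case True
  then have M: "0 < M" "1 / M \<le> 1" by auto
  have low: "(\<integral>\<^sup>+x. ennreal (M\<^sup>2) * indicator {0..1/M} x \<partial>lborel) = ennreal (M\<^sup>2 * (1 / M) - M\<^sup>2 * 0)"
    using M by (intro nn_integral_FTC_Icc) (auto intro!: derivative_eq_intros)
  have high: "(\<integral>\<^sup>+x. ennreal (1 / x\<^sup>2) * indicator {1/M..1} x \<partial>lborel) = ennreal ((- (1/1)) - (- (1 / (1 / M))))"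
  proof (rule nn_integral_FTC_Icc[where F = "\<lambda>x. - (1 / x)"])
    fix x assume "x \<in> {1 / M..1}"
    then have "1 / M \<le> x" by simp
    moreover have "0 < 1 / M" using M by simp
    ultimately have "0 < x" by linarith
    then show "((\<lambda>x. - (1 / x)) has_real_derivative 1 / x\<^sup>2) (at x)" "0 \<le> 1 / x\<^sup>2"
      by (auto intro!: derivative_eq_intros simp: power2_eq_square)
  qed (use M in auto)
  have "(\<integral>\<^sup>+x. ennreal ((cap M x)\<^sup>2) * indicator {0..<1} x \<partial>lborel) \<le>
     (\<integral>\<^sup>+x. ennreal (M\<^sup>2) * indicator {0..1/M} x + ennreal (1 / x\<^sup>2) * indicator {1/M..1} x \<partial>lborel)"
    using M by (intro nn_integral_mono) (auto simp: indicator_def cap_def max_def power_divide)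
  also have "\<dots> = ennreal M + ennreal (M - 1)"
    using low high M by (simp add: nn_integral_add power2_eq_square)
  also have "\<dots> = ennreal (M + (M - 1))"
    using True by (subst ennreal_plus) auto
  also have "\<dots> \<le> ennreal (2 * M)" by (intro ennreal_leI) auto
  finally show ?thesis by (simp add: nn_integral_unif)
next
  case False
  have "(\<integral>\<^sup>+x. ennreal ((cap M x)\<^sup>2) \<partial>unif) \<le> (\<integral>\<^sup>+x. ennreal (2 * M) \<partial>unif)"
  proof (intro nn_integral_mono ennreal_leI)
    fix x
    have "(cap M x)\<^sup>2 \<le> M\<^sup>2" using assms by (intro power_mono cap_le cap_nonneg)
    also have "\<dots> \<le> 2 * M" using False assms by (simp add: power2_eq_square)
    finally show "(cap M x)\<^sup>2 \<le> 2 * M" .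
  qed
  then show ?thesis by (simp add: emeasure_unif_space)
qed

text \<open>Young's inequality with weight \<open>2\<^sup>-\<^sup>k\<^sup>/\<^sup>2\<close> avoids the factor \<open>ln M\<close> that the
  sup norm of \<open>cap\<close> would cost.\<close>

lemma nn_integral_cap_cap:
  assumes "M > 0"
  shows "(\<integral>\<^sup>+x. ennreal (cap (M / 2 ^ k) x * cap M x) \<partial>unif) \<le> ennreal (2 * M * (1 / sqrt 2) ^ k)"
proof -
  \<comment> \<open>This weight balances the two terms of Young's inequality: each ends up as
    \<open>M * c\<close>.\<close>
  define c :: real where "c = (1 / sqrt 2) ^ k"
  have c: "c > 0" by (simp add: c_def)
  have c2: "c * c = 1 / 2 ^ k"
    by (simp add: c_def power_mult_distrib[symmetric] power_one_over)
  have young: "u * v \<le> c / 2 * v\<^sup>2 + 1 / (2 * c) * u\<^sup>2" for u v :: real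
  proof -
    have "0 \<le> (c * v - u)\<^sup>2 / (2 * c)" using c by simp
    also have "\<dots> = c / 2 * v\<^sup>2 + 1 / (2 * c) * u\<^sup>2 - u * v"
      using c by (simp add: field_simps power2_eq_square)
    finally show ?thesis by simp
  qed
  have "(\<integral>\<^sup>+x. ennreal (cap (M / 2 ^ k) x * cap M x) \<partial>unif) \<le>
     (\<integral>\<^sup>+x. ennreal (c / 2) * ennreal ((cap M x)\<^sup>2) + ennreal (1 / (2 * c)) * ennreal ((cap (M / 2 ^ k) x)\<^sup>2) \<partial>unif)"
    using c young by (intro nn_integral_mono)
      (simp add: ennreal_mult[symmetric] ennreal_plus[symmetric] del: ennreal_plus)
  also have "\<dots> = ennreal (c / 2) * (\<integral>\<^sup>+x. ennreal ((cap M x)\<^sup>2) \<partial>unif)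
      + ennreal (1 / (2 * c)) * (\<integral>\<^sup>+x. ennreal ((cap (M / 2 ^ k) x)\<^sup>2) \<partial>unif)"
    by (subst nn_integral_add) (auto simp: nn_integral_cmult borel_measurable_unif)
  also have "\<dots> \<le> ennreal (c / 2) * ennreal (2 * M) + ennreal (1 / (2 * c)) * ennreal (2 * (M / 2 ^ k))"
    using assms by (intro add_mono mult_left_mono nn_integral_cap_square) auto
  also have "\<dots> = ennreal (c / 2 * (2 * M) + 1 / (2 * c) * (2 * (M / 2 ^ k)))"
    using c assms by (simp add: ennreal_mult[symmetric] ennreal_plus[symmetric] del: ennreal_plus)
  also have "c / 2 * (2 * M) + 1 / (2 * c) * (2 * (M / 2 ^ k)) = c / 2 * (2 * M) + 1 / (2 * c) * (2 * (M * (c * c)))"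
    by (simp add: c2)
  also have "\<dots> = 2 * M * c"
    using c by (simp add: field_simps)
  finally show ?thesis by (simp add: c_def)
qed

section \<open>Variance of the capped Birkhoff sums\<close>

lemma cap_tau_integrable:
  assumes "M > 0"
  shows "integrable unif (\<lambda>x. cap M ((tau ^^ k) x))"
    "integrable unif (\<lambda>x. cap M ((tau ^^ k) x) * cap M ((tau ^^ l) x))"
proof -
  interpret finite_measure unif by (rule finite_measure_unif)
  show "integrable unif (\<lambda>x. cap M ((tau ^^ k) x))"
    using assms by (intro integrable_const_bound[where B = M] borel_measurable_unif)
      (auto simp: cap_nonneg cap_le)
  show "integrable unif (\<lambda>x. cap M ((tau ^^ k) x) * cap M ((tau ^^ l) x))"
    using assms by (intro integrable_const_bound[where B = "M * M"] borel_measurable_unif)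
      (auto simp: cap_nonneg cap_le intro!: mult_mono)
qed

lemma integral_cap_tau:
  assumes "M \<ge> 1"
  shows "(\<integral>x. cap M ((tau ^^ k) x) \<partial>unif) = 1 + ln M"
proof -
  have "(\<integral>\<^sup>+x. ennreal (cap M ((tau ^^ k) x)) \<partial>unif) = ennreal (1 + ln M)"
    using assms nn_integral_unif_tau[of "\<lambda>x. ennreal (cap M x)" k] by (simp add: nn_integral_cap)
  then show ?thesis
    using assms by (subst integral_eq_nn_integral) (auto simp: borel_measurable_unif cap_nonneg simp del: ennreal_plus)
qed

text \<open>Invariance moves the pair of times to 0 and \<open>l - k\<close>. Decorrelation then
  gives the squared mean plus the slice at 0, which by self-similarity is an integral of two caps
  whose levels differ by \<open>2 ^ (l - k)\<close>.\<close>

lemma integral_cap_tau_correlation_le: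
  assumes M: "M \<ge> 1" and "k \<le> l"
  shows "(\<integral>x. cap M ((tau ^^ k) x) * cap M ((tau ^^ l) x) \<partial>unif)
    \<le> (1 + ln M)\<^sup>2 + 2 * M * (1 / sqrt 2) ^ (l - k)"
proof -
  have M0: "M > 0" using M by simp
  define d where "d = l - k"
  have l: "(tau ^^ l) x = (tau ^^ d) ((tau ^^ k) x)" for x
    using assms by (simp add: d_def funpow_add[symmetric, THEN fun_cong, unfolded comp_def])
  have "(\<integral>\<^sup>+x. ennreal (cap M ((tau ^^ k) x) * cap M ((tau ^^ l) x)) \<partial>unif) =
     (\<integral>\<^sup>+x. ennreal (cap M x * cap M ((tau ^^ d) x)) \<partial>unif)"
    unfolding l by (intro nn_integral_unif_tau[of "\<lambda>x. ennreal (cap M x * cap M ((tau ^^ d) x))" k]) simp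
  also have "\<dots> = (\<integral>\<^sup>+x. ennreal (cap M x) * ennreal (cap M ((tau ^^ d) x)) \<partial>unif)"
    using M0 by (simp add: ennreal_mult cap_nonneg)
  also have "\<dots> \<le> ennreal (1 / 2 ^ d) * (\<integral>\<^sup>+y. ennreal (cap M (y / 2 ^ d)) * ennreal (cap M y) \<partial>unif)
      + (\<integral>\<^sup>+x. ennreal (cap M x) \<partial>unif) * (\<integral>\<^sup>+x. ennreal (cap M x) \<partial>unif)"
    using M0 by (intro nn_integral_unif_decorrelation ennreal_leI cap_antimono) auto
  also have "ennreal (1 / 2 ^ d) * (\<integral>\<^sup>+y. ennreal (cap M (y / 2 ^ d)) * ennreal (cap M y) \<partial>unif) =
     (\<integral>\<^sup>+y. ennreal (1 / 2 ^ d) * (ennreal (cap M (y / 2 ^ d)) * ennreal (cap M y)) \<partial>unif)"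
    by (intro nn_integral_cmult[symmetric] borel_measurable_unif) simp
  also have "\<dots> = (\<integral>\<^sup>+y. ennreal (cap (M / 2 ^ d) y * cap M y) \<partial>unif)"
    using M0 by (simp add: ennreal_mult[symmetric] cap_nonneg cap_scale[symmetric] mult.assoc)
  also have "\<dots> \<le> ennreal (2 * M * (1 / sqrt 2) ^ d)"
    using M0 by (rule nn_integral_cap_cap)
  also have "(\<integral>\<^sup>+x. ennreal (cap M x) \<partial>unif) = ennreal (1 + ln M)"
    using M by (rule nn_integral_cap)
  also have "ennreal (2 * M * (1 / sqrt 2) ^ d) + ennreal (1 + ln M) * ennreal (1 + ln M)
     = ennreal ((1 + ln M)\<^sup>2 + 2 * M * (1 / sqrt 2) ^ d)"
    using M by (simp add: ennreal_mult[symmetric] ennreal_plus[symmetric] power2_eq_square add.commute del: ennreal_plus)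
  finally show ?thesis
    using M M0 unfolding d_def
    by (subst integral_eq_nn_integral)
       (auto simp: borel_measurable_unif cap_nonneg intro!: enn2real_leI)
qed

text \<open>\<open>max k l - min k l\<close> is the distance of \<open>k\<close> and
  \<open>l\<close> in natural numbers. The two one-sided geometric series both count the diagonal,
  which only loosens the bound.\<close>

lemma sum_geometric_two_sided:
  fixes q :: real
  assumes q: "0 \<le> q" "q < 1"
  shows "(\<Sum>l<n. q ^ (max k l - min k l)) \<le> 2 / (1 - q)"
proof -
  have fin: "(\<Sum>i\<in>A. q ^ i) \<le> 1 / (1 - q)" if "finite A" for A
    using sum_le_suminf[OF summable_geometric that, of q] q by (simp add: suminf_geometric)
  have "(\<Sum>l<n. q ^ (max k l - min k l)) \<le> (\<Sum>l\<in>{..k} \<union> {k..<k+n}. q ^ (max k l - min k l))"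
    using q by (intro sum_mono2) auto
  also have "\<dots> \<le> (\<Sum>l\<in>{..k}. q ^ (max k l - min k l)) + (\<Sum>l\<in>{k..<k+n}. q ^ (max k l - min k l))"
    using q by (subst sum_Un) (auto intro!: sum_nonneg)
  also have "(\<Sum>l\<in>{..k}. q ^ (max k l - min k l)) = (\<Sum>i\<in>{..k}. q ^ i)"
    by (rule sum.reindex_bij_witness[of _ "\<lambda>i. k - i" "\<lambda>i. k - i"]) (auto simp: max_def min_def)
  also have "(\<Sum>l\<in>{k..<k+n}. q ^ (max k l - min k l)) = (\<Sum>i\<in>{..<n}. q ^ i)"
    by (rule sum.reindex_bij_witness[of _ "\<lambda>i. k + i" "\<lambda>i. i - k"]) (auto simp: max_def min_def)
  finally show ?thesis using fin[of "{..k}"] fin[of "{..<n}"] by simp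
qed

text \<open>After expanding the square, the squared means cancel. Each of the \<open>n\<close> rows
  of correlations leaves at most \<open>2 * M\<close> times a two-sided geometric sum, whence the
  constant \<open>4 / (1 - 1 / sqrt 2)\<close>.\<close>

lemma variance_sum_cap_le:
  assumes M: "M \<ge> 1"
  shows "integrable unif (\<lambda>x. ((\<Sum>k<n. cap M ((tau ^^ k) x)) - n * (1 + ln M))\<^sup>2)"
    and "(\<integral>x. ((\<Sum>k<n. cap M ((tau ^^ k) x)) - n * (1 + ln M))\<^sup>2 \<partial>unif)
      \<le> 4 / (1 - 1 / sqrt 2) * n * M"
proof -
  interpret finite_measure unif by (rule finite_measure_unif)
  have M0: "M > 0" using M by simp
  define m where "m = 1 + ln M"
  let ?g = "\<lambda>k x. cap M ((tau ^^ k) x)"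
  have expand: "((\<Sum>k<n. ?g k x) - n * m)\<^sup>2 =
     (\<Sum>k<n. \<Sum>l<n. ?g k x * ?g l x) - 2 * n * m * (\<Sum>k<n. ?g k x) + (n * m)\<^sup>2" for x
  proof -
    have "((\<Sum>k<n. ?g k x) - n * m)\<^sup>2 =
        (\<Sum>k<n. ?g k x) * (\<Sum>k<n. ?g k x) - 2 * n * m * (\<Sum>k<n. ?g k x) + (n * m)\<^sup>2"
      by (simp add: power2_eq_square algebra_simps)
    then show ?thesis by (simp only: sum_product)
  qed
  note int = cap_tau_integrable[OF M0]
  show "integrable unif (\<lambda>x. ((\<Sum>k<n. cap M ((tau ^^ k) x)) - n * (1 + ln M))\<^sup>2)"
    unfolding m_def[symmetric] expand
    by (intro Bochner_Integration.integrable_add Bochner_Integration.integrable_diff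
      Bochner_Integration.integrable_sum integrable_mult_right int integrable_const)
  have m1: "measure unif (space unif) = 1" by (simp add: measure_def emeasure_unif_space)
  have "(\<integral>x. ((\<Sum>k<n. ?g k x) - n * m)\<^sup>2 \<partial>unif) =
     (\<Sum>k<n. \<Sum>l<n. \<integral>x. ?g k x * ?g l x \<partial>unif) - 2 * n * m * (\<Sum>k<n. \<integral>x. ?g k x \<partial>unif) + (n * m)\<^sup>2"
    unfolding expand using int m1
    by (simp add: Bochner_Integration.integral_sum Bochner_Integration.integrable_sum)
  also have "(\<Sum>k<n. \<integral>x. ?g k x \<partial>unif) = n * m"
    using M by (simp add: integral_cap_tau m_def)
  also have "(\<Sum>k<n. \<Sum>l<n. \<integral>x. ?g k x * ?g l x \<partial>unif) \<le>
     (\<Sum>k<n. \<Sum>l<n. m\<^sup>2 + 2 * M * (1 / sqrt 2) ^ (max k l - min k l))"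
  proof (intro sum_mono)
    fix k l
    show "(\<integral>x. ?g k x * ?g l x \<partial>unif) \<le> m\<^sup>2 + 2 * M * (1 / sqrt 2) ^ (max k l - min k l)"
      using integral_cap_tau_correlation_le[OF M, of k l] integral_cap_tau_correlation_le[OF M, of l k]
      by (cases "k \<le> l") (auto simp: max_def min_def m_def mult.commute)
  qed
  also have "\<dots> = n * n * m\<^sup>2 + 2 * M * (\<Sum>k<n. \<Sum>l<n. (1 / sqrt 2) ^ (max k l - min k l))"
    by (simp add: sum.distrib sum_distrib_left)
  also have "(\<Sum>k<n. \<Sum>l<n. (1 / sqrt 2) ^ (max k l - min k l)) \<le> (\<Sum>k<n. 2 / (1 - 1 / sqrt 2))"
    by (intro sum_mono sum_geometric_two_sided) auto
  finally show "(\<integral>x. ((\<Sum>k<n. cap M ((tau ^^ k) x)) - n * (1 + ln M))\<^sup>2 \<partial>unif)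
      \<le> 4 / (1 - 1 / sqrt 2) * n * M"
    using M0 unfolding m_def[symmetric] by (simp add: power2_eq_square algebra_simps)
qed

section \<open>The strong law for capped sums\<close>

text \<open>The series of the \<open>f j\<close> has finite integral, so it converges almost
  everywhere and its terms tend to 0. This stands in for Chebyshev's inequality followed by
  Borel-Cantelli.\<close>

lemma AE_tendsto_0_of_summable_integral:
  fixes f :: "nat \<Rightarrow> 'a \<Rightarrow> real"
  assumes int: "\<And>j. integrable M (f j)" and nonneg: "\<And>j x. 0 \<le> f j x"
    and sum: "summable (\<lambda>j. \<integral>x. f j x \<partial>M)"
  shows "AE x in M. (\<lambda>j. f j x) \<longlonglongrightarrow> 0"
proof -
  have [measurable]: "f j \<in> borel_measurable M" for j using int by auto
  have "(\<integral>\<^sup>+x. (\<Sum>j. ennreal (f j x)) \<partial>M) = (\<Sum>j. \<integral>\<^sup>+x. ennreal (f j x) \<partial>M)"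
    by (intro nn_integral_suminf) simp
  also have "\<dots> = (\<Sum>j. ennreal (\<integral>x. f j x \<partial>M))"
    using int nonneg by (intro suminf_cong nn_integral_eq_integral) auto
  also have "\<dots> \<noteq> \<infinity>"
    using sum nonneg by (subst suminf_ennreal2) auto
  finally have "AE x in M. (\<Sum>j. ennreal (f j x)) \<noteq> \<infinity>"
    by (intro nn_integral_PInf_AE) simp_all
  then show ?thesis
  proof eventually_elim
    case (elim x)
    then have "summable (\<lambda>j. f j x)"
      using nonneg by (intro summable_suminf_not_top) auto
    then show ?case by (rule summable_LIMSEQ_zero)
  qed
qed

text \<open>The exponent 3/4 is the largest for which trimming o((ln t)^(1/4)) terms of this size
  always costs only o(t ln t).\<close>

definition level :: "real \<Rightarrow> real" where
  "level t = t * ln t powr (3/4)"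

text \<open>Time is real so that the sum can be sampled at epochs that are not integers. The level
  moves with \<open>t\<close> and applies to all terms at once.\<close>

definition capped_sum :: "real \<Rightarrow> real \<Rightarrow> real" where
  "capped_sum t x = (\<Sum>k<nat \<lfloor>t\<rfloor>. cap (level t) ((tau ^^ k) x))"

lemma one_le_of_exp_1_le: "exp 1 \<le> t \<Longrightarrow> 1 \<le> (t :: real)"
  using exp_ge_add_one_self[of "1::real"] by linarith

lemma ln_ge_1:
  fixes t :: real
  assumes "exp 1 \<le> t"
  shows "1 \<le> ln t"
  using one_le_of_exp_1_le[OF assms] assms by (subst ln_ge_iff) auto

lemma level_ge_1: assumes "exp 1 \<le> t" shows "1 \<le> level t"
proof -
  have "1 \<le> ln t powr (3/4)" using ln_ge_1[OF assms] by (intro ge_one_powr_ge_zero) auto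
  moreover have "1 \<le> t" using assms by (rule one_le_of_exp_1_le)
  ultimately show ?thesis unfolding level_def using mult_mono[of 1 t 1 "ln t powr (3/4)"] by simp
qed

lemma level_mono: assumes "exp 1 \<le> s" "s \<le> t" shows "level s \<le> level t"
proof -
  have "0 < s" using assms(1) exp_gt_zero[of "1::real"] by linarith
  moreover have "ln s \<le> ln t" using calculation assms(2) by (intro ln_mono)
  ultimately show ?thesis
    unfolding level_def using assms(2) ln_ge_1[OF assms(1)] one_le_of_exp_1_le[OF assms(1)]
    by (intro mult_mono powr_mono2) auto
qed

lemma capped_sum_mono: assumes "exp 1 \<le> s" "s \<le> t" shows "capped_sum s x \<le> capped_sum t x"
proof -
  have lv: "1 \<le> level s" "1 \<le> level t" "level s \<le> level t"
    using assms by (auto intro: level_ge_1 level_mono)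
  have "capped_sum s x \<le> (\<Sum>k<nat \<lfloor>s\<rfloor>. cap (level t) ((tau ^^ k) x))"
    unfolding capped_sum_def using lv by (intro sum_mono cap_mono) auto
  also have "\<dots> \<le> capped_sum t x"
    unfolding capped_sum_def using assms lv
    by (intro sum_mono2 cap_nonneg lessThan_subset_iff[THEN iffD2] nat_mono floor_mono) auto
  finally show ?thesis .
qed

lemma capped_sum_nonneg: "exp 1 \<le> t \<Longrightarrow> 0 \<le> capped_sum t x"
  unfolding capped_sum_def using level_ge_1[of t] by (intro sum_nonneg cap_nonneg) simp

text \<open>The exponent \<open>9/10\<close> is small enough for \<open>epoch (j + 1) / epoch j\<close> to tend to 1, and large
  enough for the Chebyshev bounds, of order \<open>(ln t) powr (-5/4)\<close> at time \<open>t\<close>, to be summable.\<close>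

definition epoch :: "nat \<Rightarrow> real" where
  "epoch j = exp (real (Suc j) powr (9/10))"

lemma ln_epoch: "ln (epoch j) = real (Suc j) powr (9/10)"
  by (simp add: epoch_def)

lemma epoch_ge: "exp 1 \<le> epoch j"
  unfolding epoch_def by (simp add: ge_one_powr_ge_zero)

lemma epoch_at_top: "filterlim epoch at_top sequentially"
  unfolding epoch_def by real_asymp

text \<open>The increments of \<open>j powr (9/10)\<close> tend to 0 because the exponent is below
  1, so passing to the next epoch does not change the normalisation asymptotically.\<close>

lemma epoch_ratio: "(\<lambda>j. (epoch (Suc j) * ln (epoch (Suc j))) / (epoch j * ln (epoch j))) \<longlonglongrightarrow> 1"
proof -
  have "(\<lambda>j. real (Suc (Suc j)) powr (9/10) - real (Suc j) powr (9/10)) \<longlonglongrightarrow> 0"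
    by real_asymp
  then have "(\<lambda>j. exp (real (Suc (Suc j)) powr (9/10) - real (Suc j) powr (9/10))) \<longlonglongrightarrow> exp 0"
    by (rule tendsto_exp)
  moreover have "(\<lambda>j. real (Suc (Suc j)) powr (9/10) / real (Suc j) powr (9/10)) \<longlonglongrightarrow> 1"
    by real_asymp
  ultimately have "(\<lambda>j. exp (real (Suc (Suc j)) powr (9/10) - real (Suc j) powr (9/10)) *
      (real (Suc (Suc j)) powr (9/10) / real (Suc j) powr (9/10))) \<longlonglongrightarrow> exp 0 * 1"
    by (rule tendsto_mult)
  then show ?thesis
    unfolding ln_epoch unfolding epoch_def by (simp add: exp_diff)
qed

lemma epoch_ratio': "(\<lambda>j. (epoch j * ln (epoch j)) / (epoch (Suc j) * ln (epoch (Suc j)))) \<longlonglongrightarrow> 1"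
  using tendsto_inverse[OF epoch_ratio] by simp

text \<open>Inverse of \<open>epoch\<close>: 10/9 undoes the exponent 9/10, and the subtracted 1
  undoes the \<open>Suc\<close> in \<open>epoch\<close>.\<close>

definition epoch_index :: "nat \<Rightarrow> nat" where
  "epoch_index n = nat \<lfloor>ln (real n) powr (10/9)\<rfloor> - 1"

lemma epoch_index_at_top: "filterlim epoch_index at_top sequentially"
proof -
  have "filterlim (\<lambda>n::nat. ln (real n) powr (10/9)) at_top sequentially" by real_asymp
  then have "filterlim (\<lambda>n::nat. nat \<lfloor>ln (real n) powr (10/9)\<rfloor>) at_top sequentially"
    by (intro filterlim_compose[OF filterlim_nat_sequentially]
          filterlim_compose[OF filterlim_floor_sequentially])
  then show ?thesis
    unfolding epoch_index_def filterlim_at_top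
    by (metis (mono_tags, lifting) add_le_imp_le_diff eventually_mono)
qed

lemma epoch_index_bounds:
  assumes "exp 1 \<le> real n"
  shows "epoch (epoch_index n) \<le> real n" "real n \<le> epoch (Suc (epoch_index n))"
proof -
  define L where "L = ln (real n) powr (10/9)"
  have l1: "1 \<le> ln (real n)" using assms by (rule ln_ge_1)
  have n0: "0 < real n" using assms exp_gt_zero[of "1::real"] by linarith
  have L1: "1 \<le> L" unfolding L_def using l1 by (intro ge_one_powr_ge_zero) auto
  have inv: "L powr (9/10) = ln (real n)"
    unfolding L_def using l1 by (simp add: powr_powr)
  have "1 \<le> \<lfloor>L\<rfloor>" using L1 by (simp add: le_floor_iff)
  then have S: "real (Suc (epoch_index n)) = of_int \<lfloor>L\<rfloor>"
    unfolding epoch_index_def L_def[symmetric] by (simp add: of_nat_diff nat_diff_distrib[symmetric])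
  have "of_int \<lfloor>L\<rfloor> powr (9/10) \<le> L powr (9/10)"
    using L1 by (intro powr_mono2) auto
  then show "epoch (epoch_index n) \<le> real n"
    unfolding epoch_def S inv using n0 by (metis exp_le_cancel_iff exp_ln)
  have "L powr (9/10) \<le> (of_int \<lfloor>L\<rfloor> + 1) powr (9/10)"
    using L1 by (intro powr_mono2) auto
  moreover have "real (Suc (Suc (epoch_index n))) = of_int \<lfloor>L\<rfloor> + 1" using S by simp
  ultimately show "real n \<le> epoch (Suc (epoch_index n))"
    unfolding epoch_def inv using n0 by (metis exp_le_cancel_iff exp_ln)
qed

lemma eventually_ge_exp_1: "\<forall>\<^sub>F n in sequentially. exp 1 \<le> real n"
  by real_asymp

text \<open>Numerator and normaliser are both monotone, so the quotient at \<open>n\<close> lies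
  between quotients formed from the neighbouring epochs. These differ from the epoch values by
  factors tending to 1.\<close>

lemma tendsto_interpolate_epochs:
  fixes F :: "real \<Rightarrow> real"
  assumes mono: "\<And>s t. exp 1 \<le> s \<Longrightarrow> s \<le> t \<Longrightarrow> F s \<le> F t"
    and nonneg: "\<And>t. exp 1 \<le> t \<Longrightarrow> 0 \<le> F t"
    and lim: "(\<lambda>j. F (epoch j) / (epoch j * ln (epoch j))) \<longlonglongrightarrow> 1"
  shows "(\<lambda>n. F (real n) / (real n * ln (real n))) \<longlonglongrightarrow> 1"
proof -
  define r where "r t = t * ln t" for t :: real
  have r_pos: "0 < r t" if "exp 1 \<le> t" for t
    using ln_ge_1[OF that] that exp_gt_zero[of "1::real"] unfolding r_def by (intro mult_pos_pos) linarith+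
  have r_mono: "r s \<le> r t" if "exp 1 \<le> s" "s \<le> t" for s t
  proof -
    have "0 < s" using that(1) exp_gt_zero[of "1::real"] by linarith
    moreover have "ln s \<le> ln t" using calculation that(2) by (intro ln_mono)
    ultimately show ?thesis
      unfolding r_def using that(2) ln_ge_1[OF that(1)] one_le_of_exp_1_le[OF that(1)] by (intro mult_mono) auto
  qed
  have lim': "(\<lambda>j. F (epoch j) / r (epoch j)) \<longlonglongrightarrow> 1" using lim by (simp add: r_def)
  have up: "(\<lambda>j. F (epoch (Suc j)) / r (epoch (Suc j)) * (r (epoch (Suc j)) / r (epoch j))) \<longlonglongrightarrow> 1 * 1"
    using epoch_ratio by (intro tendsto_mult LIMSEQ_Suc[OF lim']) (simp add: r_def)
  have lo: "(\<lambda>j. F (epoch j) / r (epoch j) * (r (epoch j) / r (epoch (Suc j)))) \<longlonglongrightarrow> 1 * 1"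
    using epoch_ratio' by (intro tendsto_mult lim') (simp add: r_def)
  show ?thesis
    unfolding r_def[symmetric]
  proof (rule tendsto_sandwich)
    let ?i = epoch_index
    show "(\<lambda>n. F (epoch (?i n)) / r (epoch (?i n)) * (r (epoch (?i n)) / r (epoch (Suc (?i n))))) \<longlonglongrightarrow> 1"
      using filterlim_compose[OF lo epoch_index_at_top] by simp
    show "(\<lambda>n. F (epoch (Suc (?i n))) / r (epoch (Suc (?i n))) * (r (epoch (Suc (?i n))) / r (epoch (?i n)))) \<longlonglongrightarrow> 1"
      using filterlim_compose[OF up epoch_index_at_top] by simp
    show "\<forall>\<^sub>F n in sequentially. F (epoch (?i n)) / r (epoch (?i n)) * (r (epoch (?i n)) / r (epoch (Suc (?i n))))
      \<le> F (real n) / r (real n)"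
      using eventually_ge_exp_1
    proof eventually_elim
      case (elim n)
      note b = epoch_index_bounds[OF elim]
      have "F (epoch (?i n)) / r (epoch (Suc (?i n))) \<le> F (real n) / r (real n)"
        using b elim epoch_ge by (intro frac_le mono nonneg r_pos r_mono) auto
      then show ?case using r_pos[OF epoch_ge, of "?i n"] by simp
    qed
    show "\<forall>\<^sub>F n in sequentially. F (real n) / r (real n) \<le>
       F (epoch (Suc (?i n))) / r (epoch (Suc (?i n))) * (r (epoch (Suc (?i n))) / r (epoch (?i n)))"
      using eventually_ge_exp_1
    proof eventually_elim
      case (elim n)
      note b = epoch_index_bounds[OF elim]
      have "F (real n) / r (real n) \<le> F (epoch (Suc (?i n))) / r (epoch (?i n))"
        using b elim epoch_ge by (intro frac_le mono nonneg r_pos r_mono) auto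
      then show ?case using r_pos[OF epoch_ge, of "Suc (?i n)"] by simp
    qed
  qed
qed

section \<open>Almost sure asymptotics of the capped sums\<close>

lemma capped_sum_mean_asymp:
  "((\<lambda>t. real (nat \<lfloor>t\<rfloor>) * (1 + ln (level t)) / (t * ln t)) \<longlongrightarrow> 1) at_top"
proof (rule tendsto_sandwich)
  \<comment> \<open>The logarithm of \<open>level t\<close> is ln t + (3/4) ln ln t, and the second
    summand is negligible. The floor is bracketed by \<open>t - 1\<close> and
    \<open>t\<close>.\<close>
  show "((\<lambda>t::real. (t - 1) * (1 + ln (level t)) / (t * ln t)) \<longlongrightarrow> 1) at_top"
    "((\<lambda>t::real. t * (1 + ln (level t)) / (t * ln t)) \<longlongrightarrow> 1) at_top"
    unfolding level_def by real_asymp+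
  have ev: "\<forall>\<^sub>F t in at_top. exp 1 \<le> (t::real)" by (rule eventually_ge_at_top)
  have nn: "0 \<le> 1 + ln (level t)" "0 \<le> t * ln t" "real (nat \<lfloor>t\<rfloor>) \<le> t" "t - 1 \<le> real (nat \<lfloor>t\<rfloor>)"
    if "exp 1 \<le> t" for t
  proof -
    have "0 < t" using that exp_gt_zero[of "1::real"] by linarith
    then show "0 \<le> 1 + ln (level t)" "0 \<le> t * ln t" "real (nat \<lfloor>t\<rfloor>) \<le> t" "t - 1 \<le> real (nat \<lfloor>t\<rfloor>)"
      using level_ge_1[OF that] ln_ge_1[OF that] one_le_of_exp_1_le[OF that] by (auto intro!: mult_nonneg_nonneg)
  qed
  show "\<forall>\<^sub>F t in at_top. (t - 1) * (1 + ln (level t)) / (t * ln t) \<le> real (nat \<lfloor>t\<rfloor>) * (1 + ln (level t)) / (t * ln t)"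
    using ev by eventually_elim (intro divide_right_mono mult_right_mono nn)
  show "\<forall>\<^sub>F t in at_top. real (nat \<lfloor>t\<rfloor>) * (1 + ln (level t)) / (t * ln t) \<le> t * (1 + ln (level t)) / (t * ln t)"
    using ev by eventually_elim (intro divide_right_mono mult_right_mono nn)
qed

theorem capped_sum_strong_law:
  "AE x in unif. (\<lambda>n. capped_sum (real n) x / (real n * ln (real n))) \<longlonglongrightarrow> 1"
proof -
  define C :: real where "C = 4 / (1 - 1 / sqrt 2)"
  have C: "C > 0" by (simp add: C_def)
  define \<mu> where "\<mu> t = real (nat \<lfloor>t\<rfloor>) * (1 + ln (level t))" for t
  define Y where "Y j x = ((capped_sum (epoch j) x - \<mu> (epoch j)) / (epoch j * ln (epoch j)))\<^sup>2" for j x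
  have bound: "(\<integral>x. Y j x \<partial>unif) \<le> C * real (Suc j) powr (-9/8)"
    and int: "integrable unif (Y j)" for j
  proof -
    define t where "t = epoch j"
    have t: "exp 1 \<le> t" by (simp add: t_def epoch_ge)
    have t0: "0 < t" using t exp_gt_zero[of "1::real"] by linarith
    have l1: "1 \<le> ln t" using t by (rule ln_ge_1)
    note var = variance_sum_cap_le[OF level_ge_1[OF t], of "nat \<lfloor>t\<rfloor>"]
    have Y: "Y j = (\<lambda>x. ((\<Sum>k<nat \<lfloor>t\<rfloor>. cap (level t) ((tau ^^ k) x)) - \<mu> t)\<^sup>2 / (t * ln t)\<^sup>2)"
      by (simp add: fun_eq_iff Y_def t_def capped_sum_def power_divide)
    show "integrable unif (Y j)" unfolding Y using var(1) by (simp add: \<mu>_def)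
    have "(\<integral>x. Y j x \<partial>unif) =
        (\<integral>x. ((\<Sum>k<nat \<lfloor>t\<rfloor>. cap (level t) ((tau ^^ k) x)) - \<mu> t)\<^sup>2 \<partial>unif) / (t * ln t)\<^sup>2"
      unfolding Y by simp
    also have "\<dots> \<le> C * real (nat \<lfloor>t\<rfloor>) * level t / (t * ln t)\<^sup>2"
      unfolding \<mu>_def C_def using var(2) by (rule divide_right_mono) simp
    also have "\<dots> \<le> C * t * level t / (t * ln t)\<^sup>2"
      using t0 C level_ge_1[OF t] by (intro divide_right_mono mult_right_mono mult_left_mono) auto
    also have "\<dots> = C * (ln t powr (3/4) / (ln t)\<^sup>2)"
      using t0 by (simp add: level_def power2_eq_square)
    also have "ln t powr (3/4) / (ln t)\<^sup>2 = ln t powr (3/4 - 2)"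
      using one_le_of_exp_1_le[OF t] l1 by (subst powr_diff) (simp add: powr_numeral)
    \<comment> \<open>At an epoch the power -5/4 of the logarithm becomes -5/4 * 9/10 = -9/8, which
      is below -1 and hence summable.\<close>
    also have "\<dots> = real (Suc j) powr (-9/8)"
      unfolding t_def ln_epoch by (simp add: powr_powr)
    finally show "(\<integral>x. Y j x \<partial>unif) \<le> C * real (Suc j) powr (-9/8)" by simp
  qed
  have "summable (\<lambda>j. real (Suc j) powr (-9/8))"
    using summable_Suc_iff[of "\<lambda>j. real j powr (-9/8)"] by (simp add: summable_real_powr_iff del: of_nat_Suc)
  then have "summable (\<lambda>j. \<integral>x. Y j x \<partial>unif)"
  proof (rule summable_comparison_test'[OF summable_mult[where c = C]])
    show "norm (\<integral>x. Y j x \<partial>unif) \<le> C * real (Suc j) powr (-9/8)" for j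
      using bound[of j] by (simp add: Y_def del: of_nat_Suc)
  qed
  then have "AE x in unif. (\<lambda>j. Y j x) \<longlonglongrightarrow> 0"
    using int by (rule AE_tendsto_0_of_summable_integral[rotated 2]) (simp add: Y_def)
  then show ?thesis
  proof eventually_elim
    case (elim x)
    have "(\<lambda>j. (capped_sum (epoch j) x - \<mu> (epoch j)) / (epoch j * ln (epoch j))) \<longlonglongrightarrow> 0"
      using tendsto_real_sqrt[OF elim] unfolding Y_def by (simp add: tendsto_rabs_zero_iff del: abs_divide)
    then have "(\<lambda>j. (capped_sum (epoch j) x - \<mu> (epoch j)) / (epoch j * ln (epoch j))
        + \<mu> (epoch j) / (epoch j * ln (epoch j))) \<longlonglongrightarrow> 0 + 1"
      unfolding \<mu>_def
      by (intro tendsto_add filterlim_compose[OF capped_sum_mean_asymp epoch_at_top])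
    then have "(\<lambda>j. capped_sum (epoch j) x / (epoch j * ln (epoch j))) \<longlonglongrightarrow> 1"
      by (simp add: diff_divide_distrib)
    with capped_sum_mono capped_sum_nonneg show ?case
      by (rule tendsto_interpolate_epochs[where F = "\<lambda>t. capped_sum t x"])
  qed
qed

section \<open>Rare events\<close>

lemma emeasure_unif_below: "0 \<le> \<delta> \<Longrightarrow> emeasure unif {x \<in> {0..<1}. x < \<delta>} \<le> ennreal \<delta>"
proof -
  assume "0 \<le> \<delta>"
  have "emeasure unif {x \<in> {0..<1}. x < \<delta>} = emeasure lborel {x \<in> {0..<1}. x < \<delta>}"
    by (intro emeasure_restrict_space) auto
  also have "\<dots> \<le> emeasure lborel {0..<\<delta>}" by (intro emeasure_mono) auto
  finally show ?thesis using \<open>0 \<le> \<delta>\<close> by simp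
qed

lemma nn_integral_unif_below:
  assumes "0 \<le> \<delta>"
  shows "(\<integral>\<^sup>+x. indicator {..<\<delta>} x \<partial>unif) \<le> ennreal \<delta>"
proof -
  have "(\<integral>\<^sup>+x. indicator {..<\<delta>} x \<partial>unif) = (\<integral>\<^sup>+x. indicator {x \<in> {0..<1}. x < \<delta>} x \<partial>unif)"
    by (intro nn_integral_cong) (auto simp: indicator_def)
  also have "\<dots> = emeasure unif {x \<in> {0..<1}. x < \<delta>}"
    by (intro nn_integral_indicator) (auto simp: sets_restrict_space_iff)
  finally show ?thesis using emeasure_unif_below[OF assms] by simp
qed

lemma sets_unif_Collect:
  assumes "{x. P x} \<in> sets borel"
  shows "{x \<in> {0..<1}. P x} \<in> sets unif"
proof -
  have "{x \<in> {0..<1}. P x} = {x. P x} \<inter> {0..<1}" by auto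
  then show ?thesis using assms by (auto simp: sets_restrict_space_iff)
qed

lemma emeasure_unif_eq_nn_integral:
  assumes "{x. P x} \<in> sets borel"
  shows "emeasure unif {x \<in> {0..<1}. P x} = (\<integral>\<^sup>+x. indicator {x. P x} x \<partial>unif)"
proof -
  have "emeasure unif {x \<in> {0..<1}. P x} = (\<integral>\<^sup>+x. indicator {x \<in> {0..<1}. P x} x \<partial>unif)"
    using sets_unif_Collect[OF assms] by simp
  also have "\<dots> = (\<integral>\<^sup>+x. indicator {x. P x} x \<partial>unif)"
    by (intro nn_integral_cong) (auto simp: indicator_def)
  finally show ?thesis .
qed

lemma emeasure_unif_tau_below:
  assumes "0 \<le> \<delta>"
  shows "emeasure unif {x \<in> {0..<1}. (tau ^^ k) x < \<delta>} \<le> ennreal \<delta>"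
proof -
  have "emeasure unif {x \<in> {0..<1}. (tau ^^ k) x < \<delta>} = (\<integral>\<^sup>+x. indicator {..<\<delta>} ((tau ^^ k) x) \<partial>unif)"
    by (subst emeasure_unif_eq_nn_integral) (auto simp: indicator_def intro!: nn_integral_cong)
  also have "\<dots> = (\<integral>\<^sup>+x. indicator {..<\<delta>} x \<partial>unif)"
    by (intro nn_integral_unif_tau) simp
  also have "\<dots> \<le> ennreal \<delta>" using assms by (rule nn_integral_unif_below)
  finally show ?thesis .
qed

text \<open>By invariance every preimage of 0 is a null set. Off their countable union no term is
  infinite, so the extended real sums become real ones.\<close>

lemma AE_tau_pos: "AE x in unif. \<forall>k. 0 < (tau ^^ k) x"
proof (subst AE_all_countable, intro allI)
  fix k
  have "(\<integral>\<^sup>+x. indicator {0} ((tau ^^ k) x) \<partial>unif) = (\<integral>\<^sup>+x. indicator {0} x \<partial>unif)"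
    by (intro nn_integral_unif_tau) simp
  also have "\<dots> = (\<integral>\<^sup>+x. 0 \<partial>(lborel :: real measure))"
    unfolding nn_integral_unif
    by (intro nn_integral_cong_AE eventually_mono[OF AE_lborel_singleton[of 0]]) simp
  finally have "(\<integral>\<^sup>+x. indicator {0} ((tau ^^ k) x) \<partial>unif) = 0" by simp
  moreover have "(\<lambda>x. indicator {0} ((tau ^^ k) x) :: ennreal) \<in> borel_measurable unif"
    by (intro borel_measurable_unif) simp
  ultimately have "AE x in unif. (indicator {0} ((tau ^^ k) x) :: ennreal) = 0"
    by (simp only: nn_integral_0_iff_AE)
  moreover have "AE x in unif. x \<in> space unif" by (rule AE_space)
  ultimately show "AE x in unif. 0 < (tau ^^ k) x"
  proof eventually_elim
    case (elim x)
    then show ?case using tau_funpow_range[of x k] by (auto simp: indicator_def split: if_splits)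
  qed
qed

text \<open>The last conjunct says that the orbit leaves the expanding branch at 0 between the two visits.\<close>

definition two_visits :: "nat \<Rightarrow> real \<Rightarrow> real \<Rightarrow> bool" where
  "two_visits N \<delta> x \<longleftrightarrow> (\<exists>k<N. \<exists>d<N. (tau ^^ k) x < \<delta> \<and> (tau ^^ (d + k)) x < \<delta> \<and> 1 \<le> 2 ^ d * (tau ^^ k) x)"

lemma two_visits_mono:
  "two_visits N \<delta> x \<Longrightarrow> N \<le> N' \<Longrightarrow> \<delta> \<le> \<delta>' \<Longrightarrow> two_visits N' \<delta>' x"
  unfolding two_visits_def by (meson order_less_le_trans)

text \<open>A union bound over \<open>N * N\<close> pairs of times. The condition of having left the
  branch at 0 gives each pair the probability bound \<open>\<delta>\<^sup>2\<close> of independent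
  visits.\<close>

lemma emeasure_two_visits:
  assumes "0 \<le> \<delta>"
  shows "emeasure unif {x \<in> {0..<1}. two_visits N \<delta> x} \<le> ennreal ((N * \<delta>)\<^sup>2)"
proof -
  define E where "E k d = {x \<in> {0..<1}. (tau ^^ k) x < \<delta> \<and> (tau ^^ (d + k)) x < \<delta> \<and> 1 \<le> 2 ^ d * (tau ^^ k) x}" for k d
  have sets: "E k d \<in> sets unif" for k d
    unfolding E_def by (rule sets_unif_Collect) simp
  have one: "emeasure unif (E k d) \<le> ennreal (\<delta>\<^sup>2)" for k d
  proof -
    let ?i = "indicator {..<\<delta>} :: real \<Rightarrow> ennreal"
    have "emeasure unif (E k d) = (\<integral>\<^sup>+x. (\<lambda>y. ?i y * indicator {1..} (2 ^ d * y) * ?i ((tau ^^ d) y)) ((tau ^^ k) x) \<partial>unif)"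
      unfolding E_def
      by (subst emeasure_unif_eq_nn_integral) (auto simp: indicator_def funpow_add intro!: nn_integral_cong)
    also have "\<dots> = (\<integral>\<^sup>+x. ?i x * indicator {1..} (2 ^ d * x) * ?i ((tau ^^ d) x) \<partial>unif)"
      by (intro nn_integral_unif_tau) simp
    also have "\<dots> \<le> (\<integral>\<^sup>+x. ?i x \<partial>unif) * (\<integral>\<^sup>+x. ?i x \<partial>unif)"
      by (intro nn_integral_unif_decorrelation_far) (auto simp: indicator_def)
    also have "\<dots> \<le> ennreal \<delta> * ennreal \<delta>"
      using assms by (intro mult_mono nn_integral_unif_below) auto
    finally show ?thesis using assms by (simp add: ennreal_mult power2_eq_square)
  qed
  have "{x \<in> {0..<1}. two_visits N \<delta> x} = (\<Union>(k, d)\<in>{..<N} \<times> {..<N}. E k d)"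
    by (auto simp: two_visits_def E_def)
  also have "emeasure unif \<dots> \<le> (\<Sum>(k, d)\<in>{..<N} \<times> {..<N}. emeasure unif (E k d))"
    using sets emeasure_subadditive_finite[of "{..<N} \<times> {..<N}" "\<lambda>(k, d). E k d" unif]
    by (auto simp: case_prod_beta')
  also have "\<dots> \<le> (\<Sum>(k, d)\<in>{..<N} \<times> {..<N}. ennreal (\<delta>\<^sup>2))"
    using one by (intro sum_mono) auto
  also have "\<dots> = ennreal ((N * \<delta>)\<^sup>2)"
    by (simp add: power2_eq_square ennreal_of_nat_eq_real_of_nat ennreal_mult[symmetric] mult_ac)
  finally show ?thesis .
qed

lemma sets_two_visits: "{x \<in> {0..<1}. two_visits N \<delta> x} \<in> sets unif"
  unfolding two_visits_def by (rule sets_unif_Collect) measurable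

lemma AE_unif_eventually_not:
  assumes sets: "\<And>j. {x \<in> {0..<1}. P j x} \<in> sets unif"
    and le: "\<And>j. emeasure unif {x \<in> {0..<1}. P j x} \<le> ennreal (c j)"
    and c: "\<And>j. 0 \<le> c j" "summable c"
  shows "AE x in unif. \<forall>\<^sub>F j in sequentially. \<not> P j x"
proof -
  have "AE x in unif. \<forall>\<^sub>F j in sequentially. x \<in> space unif - {x \<in> {0..<1}. P j x}"
  proof (rule borel_cantelli_AE1)
    show "emeasure unif {x \<in> {0..<1}. P j x} < \<infinity>" for j
      using le_less_trans[OF le[of j] ennreal_less_top] by simp
    have "measure unif {x \<in> {0..<1}. P j x} \<le> c j" for j
      unfolding measure_def using le[of j] c(1) by (intro enn2real_leI) auto
    then show "summable (\<lambda>j. measure unif {x \<in> {0..<1}. P j x})"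
      by (intro summable_comparison_test'[OF c(2)]) auto
  qed (rule sets)
  then show ?thesis
    by (auto elim!: eventually_mono)
qed

lemma AE_eventually_not_two_visits:
  "AE x in unif. \<forall>\<^sub>F n in sequentially. \<not> two_visits n (1 / level (real n)) x"
proof -
  \<comment> \<open>Taking the number of times from the right end of an epoch window and the
    threshold from the left end makes one event cover every \<open>n\<close> in the window.\<close>
  define N where "N j = nat \<lfloor>epoch (Suc j)\<rfloor>" for j
  define \<delta> where "\<delta> j = 1 / level (epoch j)" for j
  have lv: "1 \<le> level (epoch j)" for j by (intro level_ge_1 epoch_ge)
  have \<delta>: "0 \<le> \<delta> j" for j using lv[of j] by (simp add: \<delta>_def)
  define c where "c j = (epoch (Suc j) * \<delta> j)\<^sup>2" for j
  have "(\<lambda>j. epoch (Suc j) / epoch j) \<longlonglongrightarrow> 1"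
  proof -
    have "(\<lambda>j. real (Suc (Suc j)) powr (9/10) - real (Suc j) powr (9/10)) \<longlonglongrightarrow> 0"
      by real_asymp
    from tendsto_exp[OF this] show ?thesis
      unfolding epoch_def by (simp add: exp_diff)
  qed
  then have "Bseq (\<lambda>j. epoch (Suc j) / epoch j)"
    by (intro convergent_imp_Bseq convergentI)
  then obtain B where B: "0 < B" "\<And>j. \<bar>epoch (Suc j) / epoch j\<bar> \<le> B"
    by (auto simp: Bseq_def)
  have c_le: "c j \<le> B\<^sup>2 * real (Suc j) powr (-27/20)" for j
  proof -
    have l: "ln (epoch j) powr (3/4) = real (Suc j) powr (27/40)"
      unfolding ln_epoch by (simp add: powr_powr)
    have "epoch (Suc j) * \<delta> j = epoch (Suc j) / epoch j * real (Suc j) powr (-27/40)"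
      unfolding \<delta>_def level_def l using powr_minus_divide[of "real (Suc j)" "27/40"] by simp
    then have "c j = (epoch (Suc j) / epoch j)\<^sup>2 * (real (Suc j) powr (-27/40))\<^sup>2"
      unfolding c_def by (simp only: power_mult_distrib)
    also have "\<dots> \<le> B\<^sup>2 * (real (Suc j) powr (-27/40))\<^sup>2"
      using B by (intro mult_right_mono abs_le_square_iff[THEN iffD1]) auto
    \<comment> \<open>The exponent is 2 * (3/4) * (9/10) = 27/20 up to sign, again beyond the
      threshold of summability.\<close>
    also have "(real (Suc j) powr (-27/40))\<^sup>2 = real (Suc j) powr (-27/20)"
      unfolding power2_eq_square powr_add[symmetric] by simp
    finally show ?thesis .
  qed
  have "summable (\<lambda>j. real (Suc j) powr (-27/20))"
    using summable_Suc_iff[of "\<lambda>j. real j powr (-27/20)"] by (simp add: summable_real_powr_iff del: of_nat_Suc)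
  from summable_mult[OF this, of "B\<^sup>2"] have "summable c"
    by (rule summable_comparison_test') (use c_le in \<open>simp add: c_def del: of_nat_Suc\<close>)
  moreover have "emeasure unif {x \<in> {0..<1}. two_visits (N j) (\<delta> j) x} \<le> ennreal (c j)" for j
  proof -
    have "emeasure unif {x \<in> {0..<1}. two_visits (N j) (\<delta> j) x} \<le> ennreal ((N j * \<delta> j)\<^sup>2)"
      using \<delta> by (rule emeasure_two_visits)
    also have "\<dots> \<le> ennreal (c j)"
      unfolding c_def N_def using \<delta> order_trans[OF one_le_of_exp_1_le epoch_ge]
      by (intro ennreal_leI power_mono mult_right_mono) (auto simp: epoch_def)
    finally show ?thesis .
  qed
  ultimately have "AE x in unif. \<forall>\<^sub>F j in sequentially. \<not> two_visits (N j) (\<delta> j) x"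
    by (intro AE_unif_eventually_not[where c = c] sets_two_visits) (auto simp: c_def)
  then show ?thesis
  proof eventually_elim
    case (elim x)
    have "\<forall>\<^sub>F n in sequentially. \<not> two_visits (N (epoch_index n)) (\<delta> (epoch_index n)) x"
      by (rule eventually_compose_filterlim[OF elim epoch_index_at_top])
    then show ?case using eventually_ge_exp_1
    proof eventually_elim
      case (elim n)
      note b = epoch_index_bounds[OF elim(2)]
      have "n \<le> N (epoch_index n)" unfolding N_def using b(2) by (simp add: le_nat_iff le_floor_iff)
      moreover have "1 / level (real n) \<le> \<delta> (epoch_index n)"
        unfolding \<delta>_def using lv[of "epoch_index n"] level_mono[OF epoch_ge b(1)]
        by (intro divide_left_mono mult_pos_pos) auto
      ultimately show ?case using elim(1) two_visits_mono by blast
    qed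
  qed
qed

text \<open>On the block of \<open>n\<close> with given integer part of \<open>ln n\<close> the
  value of \<open>\<psi>\<close> is constant and \<open>n\<close> varies by a factor e at most. A
  union bound over the block therefore costs a constant times \<open>1 / \<psi>\<close>, and
  Borel-Cantelli applies.\<close>

lemma AE_eventually_tau_ge:
  fixes \<psi> :: "nat \<Rightarrow> real"
  assumes "\<psi> \<in> Psi" and m: "0 < m"
  shows "AE x in unif. \<forall>\<^sub>F n in sequentially. \<forall>k<n. m / (real n * \<psi> (nat \<lfloor>ln (real n)\<rfloor>)) \<le> (tau ^^ k) x"
proof -
  have \<psi>_pos: "\<psi> (Suc K) > 0" for K using assms(1) by (simp add: Psi_def)
  have \<psi>_sum: "summable (\<lambda>K. 1 / \<psi> (Suc K))" using assms(1) by (simp add: Psi_def)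
  \<comment> \<open>Block \<open>K\<close> is the one on which the floor of \<open>ln n\<close> is
    \<open>Suc K\<close>; the shift keeps the argument of \<open>\<psi>\<close> at least 1, where
    \<open>Psi\<close> constrains it.\<close>
  define N where "N K = nat \<lfloor>exp (real (Suc (Suc K)))\<rfloor>" for K
  define \<delta> where "\<delta> K = m / (exp (real (Suc K)) * \<psi> (Suc K))" for K
  have \<delta>: "0 \<le> \<delta> K" for K using \<psi>_pos[of K] m by (simp add: \<delta>_def)
  have bound: "emeasure unif {x \<in> {0..<1}. \<exists>k<N K. (tau ^^ k) x < \<delta> K} \<le> ennreal (m * exp 1 * (1 / \<psi> (Suc K)))" for K
  proof -
    have "{x \<in> {0..<1}. \<exists>k<N K. (tau ^^ k) x < \<delta> K} = (\<Union>k<N K. {x \<in> {0..<1}. (tau ^^ k) x < \<delta> K})"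
      by auto
    also have "emeasure unif \<dots> \<le> (\<Sum>k<N K. emeasure unif {x \<in> {0..<1}. (tau ^^ k) x < \<delta> K})"
      by (intro emeasure_subadditive_finite image_subsetI sets_unif_Collect) auto
    also have "\<dots> \<le> (\<Sum>k<N K. ennreal (\<delta> K))"
      using \<delta> by (intro sum_mono emeasure_unif_tau_below)
    also have "\<dots> = ennreal (N K * \<delta> K)"
      using \<delta> by (simp add: ennreal_of_nat_eq_real_of_nat ennreal_mult)
    also have "\<dots> \<le> ennreal (exp (real (Suc (Suc K))) * \<delta> K)"
      using \<delta> by (intro ennreal_leI mult_right_mono) (auto simp: N_def)
    also have "exp (real (Suc (Suc K))) * \<delta> K = m * exp 1 * (1 / \<psi> (Suc K))"
    proof -
      have "exp (real (Suc (Suc K))) = exp 1 * exp (real (Suc K))"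
        by (simp add: exp_add[symmetric])
      then show ?thesis unfolding \<delta>_def by simp
    qed
    finally show ?thesis .
  qed
  have "AE x in unif. \<forall>\<^sub>F K in sequentially. \<not> (\<exists>k<N K. (tau ^^ k) x < \<delta> K)"
  proof (rule AE_unif_eventually_not[OF _ bound])
    show "{x \<in> {0..<1}. \<exists>k<N K. (tau ^^ k) x < \<delta> K} \<in> sets unif" for K
      by (rule sets_unif_Collect) measurable
    show "0 \<le> m * exp 1 * (1 / \<psi> (Suc K))" for K using \<psi>_pos[of K] m by simp
    show "summable (\<lambda>K. m * exp 1 * (1 / \<psi> (Suc K)))" using \<psi>_sum by (rule summable_mult)
  qed
  then show ?thesis
  proof eventually_elim
    case (elim x)
    have "filterlim (\<lambda>n::nat. ln (real n)) at_top sequentially" by real_asymp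
    then have "filterlim (\<lambda>n::nat. nat \<lfloor>ln (real n)\<rfloor>) at_top sequentially"
      by (intro filterlim_compose[OF filterlim_nat_sequentially]
          filterlim_compose[OF filterlim_floor_sequentially])
    then have "filterlim (\<lambda>n::nat. nat \<lfloor>ln (real n)\<rfloor> - 1) at_top sequentially"
      unfolding filterlim_at_top by (metis (mono_tags, lifting) add_le_imp_le_diff eventually_mono)
    from eventually_compose_filterlim[OF elim this]
    have "\<forall>\<^sub>F n in sequentially. \<not> (\<exists>k<N (nat \<lfloor>ln (real n)\<rfloor> - 1). (tau ^^ k) x < \<delta> (nat \<lfloor>ln (real n)\<rfloor> - 1))" .
    then show ?case using eventually_ge_exp_1
    proof eventually_elim
      case (elim n)
      define K where "K = nat \<lfloor>ln (real n)\<rfloor> - 1"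
      have l1: "1 \<le> ln (real n)" using elim(2) by (rule ln_ge_1)
      have n0: "0 < real n" using one_le_of_exp_1_le[OF elim(2)] by simp
      have "1 \<le> \<lfloor>ln (real n)\<rfloor>" using l1 by (simp add: le_floor_iff)
      then have SK: "Suc K = nat \<lfloor>ln (real n)\<rfloor>" and SKr: "real (Suc K) = of_int \<lfloor>ln (real n)\<rfloor>"
        by (auto simp: K_def of_nat_diff)
      have "real (Suc K) \<le> ln (real n)" unfolding SKr by simp
      then have low: "exp (real (Suc K)) \<le> real n" using n0 by (metis exp_le_cancel_iff exp_ln)
      have "ln (real n) \<le> real (Suc (Suc K))" using SKr by (simp add: add.commute) linarith
      then have "real n \<le> exp (real (Suc (Suc K)))" using n0 by (metis exp_le_cancel_iff exp_ln)
      then have "n \<le> N K" unfolding N_def by (simp add: le_nat_iff le_floor_iff)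
      moreover have "m / (real n * \<psi> (nat \<lfloor>ln (real n)\<rfloor>)) \<le> \<delta> K"
        unfolding \<delta>_def SK[symmetric] using m low \<psi>_pos[of K] n0
        by (intro divide_left_mono mult_right_mono mult_pos_pos) auto
      ultimately show ?case using elim(1) unfolding K_def[symmetric]
        by (meson linorder_not_less order_less_le_trans order_trans)
    qed
  qed
qed

section \<open>Trimmed sums\<close>

lemma sum_list_map_rev_sort:
  fixes g :: "'a::linorder \<Rightarrow> 'b::comm_monoid_add"
  shows "sum_list (map g (rev (sort xs))) = sum_list (map g xs)"
proof -
  have "mset (map g (rev (sort xs))) = mset (map g xs)" by simp
  then show ?thesis by (metis sum_mset_sum_list)
qed

lemma rev_sort_nth_antimono:
  "i \<le> j \<Longrightarrow> j < length xs \<Longrightarrow> rev (sort xs) ! j \<le> rev (sort xs) ! i"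
  by (simp add: rev_nth sorted_nth_mono)

text \<open>Capping at the largest surviving entry \<open>c\<close> costs exactly \<open>b * c\<close> in the full sum,
  and at most that much on any set of \<open>b\<close> indices.\<close>

lemma sum_list_drop_rev_sort_le:
  fixes f :: "nat \<Rightarrow> real"
  assumes nonneg: "\<And>k. k < n \<Longrightarrow> 0 \<le> f k" and B: "B \<subseteq> {..<n}" "card B \<le> b"
  shows "sum_list (drop b (rev (sort (map f [0..<n])))) \<le> (\<Sum>k\<in>{..<n} - B. f k)"
proof (cases "b < n")
  case True
  define zs where "zs = rev (sort (map f [0..<n]))"
  have len: "length zs = n" by (simp add: zs_def)
  define c where "c = zs ! b"
  have "c \<in> set zs" using True len by (simp add: c_def)
  then have c0: "0 \<le> c" using nonneg by (auto simp: zs_def)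
  have anti: "zs ! j \<le> zs ! i" if "i \<le> j" "j < n" for i j
    unfolding zs_def using that by (intro rev_sort_nth_antimono) auto
  have "map (\<lambda>z. min z c) (take b zs) = map (\<lambda>z. c) (take b zs)"
    using anti True len by (intro nth_equalityI) (auto simp: c_def)
  moreover have "map (\<lambda>z. min z c) (drop b zs) = drop b zs"
    using anti True len by (intro nth_equalityI) (auto simp: c_def)
  ultimately have "map (\<lambda>z. min z c) zs = map (\<lambda>z. c) (take b zs) @ drop b zs"
    by (metis append_take_drop_id map_append)
  then have "sum_list (map (\<lambda>z. min z c) zs) = b * c + sum_list (drop b zs)"
    using True len by (simp add: sum_list_triv min_def)
  moreover have "sum_list (map (\<lambda>z. min z c) zs) = (\<Sum>k<n. min (f k) c)"
    unfolding zs_def sum_list_map_rev_sort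
    by (simp add: o_def interv_sum_list_conv_sum_set_nat atLeast0LessThan)
  ultimately have "sum_list (drop b zs) = (\<Sum>k<n. min (f k) c) - b * c" by simp
  also have "(\<Sum>k<n. min (f k) c) = (\<Sum>k\<in>{..<n} - B. min (f k) c) + (\<Sum>k\<in>B. min (f k) c)"
    using B(1) by (intro sum.subset_diff) auto
  also have "(\<Sum>k\<in>{..<n} - B. min (f k) c) \<le> (\<Sum>k\<in>{..<n} - B. f k)"
    by (intro sum_mono) auto
  also have "(\<Sum>k\<in>B. min (f k) c) \<le> (\<Sum>k\<in>B. c)"
    by (intro sum_mono) auto
  also have "(\<Sum>k\<in>B. c) \<le> b * c"
    using B(2) c0 by (simp add: mult_right_mono)
  finally show ?thesis by (simp add: zs_def)
next
  case False
  then show ?thesis using nonneg by (auto intro!: sum_nonneg)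
qed

text \<open>Once all entries are capped at \<open>c\<close>, the removed ones account for at most
  \<open>b * c\<close>. Here \<open>c\<close> is free; it is later taken to be the level.\<close>

lemma sum_list_drop_rev_sort_ge:
  fixes f :: "nat \<Rightarrow> real"
  assumes "0 \<le> c"
  shows "(\<Sum>k<n. min (f k) c) - b * c \<le> sum_list (drop b (rev (sort (map f [0..<n]))))"
proof -
  define zs where "zs = rev (sort (map f [0..<n]))"
  have "(\<Sum>k<n. min (f k) c) = sum_list (map (\<lambda>z. min z c) zs)"
    unfolding zs_def sum_list_map_rev_sort
    by (simp add: o_def interv_sum_list_conv_sum_set_nat atLeast0LessThan)
  also have "\<dots> = sum_list (map (\<lambda>z. min z c) (take b zs)) + sum_list (map (\<lambda>z. min z c) (drop b zs))"
    by (metis append_take_drop_id map_append sum_list_append)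
  also have "sum_list (map (\<lambda>z. min z c) (take b zs)) \<le> sum_list (map (\<lambda>z. c) (take b zs))"
    by (intro sum_list_mono) auto
  also have "\<dots> \<le> b * c"
    using assms by (simp add: sum_list_triv mult_right_mono)
  also have "sum_list (map (\<lambda>z. min z c) (drop b zs)) \<le> sum_list (map (\<lambda>z. z) (drop b zs))"
    by (intro sum_list_mono) auto
  finally show ?thesis by (simp add: zs_def)
qed

text \<open>Real-valued counterpart of \<open>trimmed_sum\<close>, with times counted from 0: time
  \<open>k\<close> stands for the term \<open>a (Suc k)\<close>.\<close>

definition real_trimmed_sum :: "nat \<Rightarrow> nat \<Rightarrow> real \<Rightarrow> real" where
  "real_trimmed_sum n b x =
    sum_list (drop b (rev (sort (map (\<lambda>k. real_of_int \<lfloor>1 / (tau ^^ k) x\<rfloor>) [0..<n]))))"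

lemma sort_map_ereal: "sort (map ereal xs) = map ereal (sort xs)"
  by (rule properties_for_sort) (auto simp: sorted_map)

lemma trimmed_sum_eq_ereal:
  assumes "\<And>k. 0 < (tau ^^ k) x"
  shows "trimmed_sum n b x = ereal (real_trimmed_sum n b x)"
proof -
  have [simp]: "(tau ^^ k) x \<noteq> 0" for k using assms[of k] by simp
  have "map (\<lambda>k. a k x) [1..<Suc n] = map (\<lambda>k. a (Suc k) x) [0..<n]"
    by (simp add: map_Suc_upt[symmetric] del: upt_Suc)
  also have "\<dots> = map ereal (map (\<lambda>k. real_of_int \<lfloor>1 / (tau ^^ k) x\<rfloor>) [0..<n])"
    by (simp add: a_def chi_def)
  finally have eq: "map (\<lambda>k. a k x) [1..<Suc n] = map ereal (map (\<lambda>k. real_of_int \<lfloor>1 / (tau ^^ k) x\<rfloor>) [0..<n])" .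
  have sl: "sum_list (map ereal xs) = ereal (sum_list xs)" for xs by (induction xs) auto
  show ?thesis
    unfolding trimmed_sum_def real_trimmed_sum_def eq sort_map_ereal rev_map drop_map sl ..
qed

text \<open>Rounding \<open>1 / y\<close> down loses at most 1 per term, hence \<open>n\<close> in
  all, and trimming removes at most \<open>b\<close> capped terms.\<close>

lemma real_trimmed_sum_ge:
  assumes pos: "\<And>k. 0 < (tau ^^ k) x" and n: "exp 1 \<le> real n"
  shows "capped_sum (real n) x - n - b * level n \<le> real_trimmed_sum n b x"
proof -
  define M where "M = level (real n)"
  have M: "1 \<le> M" unfolding M_def using n by (rule level_ge_1)
  have "capped_sum (real n) x - n = (\<Sum>k<n. cap M ((tau ^^ k) x) - 1)"
    by (simp add: capped_sum_def M_def sum_subtractf)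
  also have "\<dots> \<le> (\<Sum>k<n. min (real_of_int \<lfloor>1 / (tau ^^ k) x\<rfloor>) M)"
  proof (rule sum_mono)
    fix k
    have "1 / (tau ^^ k) x - 1 \<le> real_of_int \<lfloor>1 / (tau ^^ k) x\<rfloor>" by linarith
    moreover have "cap M ((tau ^^ k) x) = min (1 / (tau ^^ k) x) M"
      using M pos[of k] by (simp add: cap_eq_min)
    ultimately show "cap M ((tau ^^ k) x) - 1 \<le> min (real_of_int \<lfloor>1 / (tau ^^ k) x\<rfloor>) M"
      by (intro min.boundedI) linarith+
  qed
  finally show ?thesis
    using sum_list_drop_rev_sort_ge[of M "\<lambda>k. real_of_int \<lfloor>1 / (tau ^^ k) x\<rfloor>" n b] M
    unfolding real_trimmed_sum_def M_def by simp
qed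

text \<open>Without two visits, all times below \<open>n\<close> at which the orbit is near 0 belong to one run
  along which the point doubles at each step.  Trim its first \<open>b\<close> times.\<close>

lemma real_trimmed_sum_le:
  assumes x: "x \<in> {0..<1}" and pos: "\<And>k. 0 < (tau ^^ k) x" and n: "exp 1 \<le> real n"
    and single: "\<not> two_visits n (1 / level n) x"
    and D: "0 < D" "\<And>k. k < n \<Longrightarrow> D \<le> (tau ^^ k) x"
  shows "real_trimmed_sum n b x \<le> capped_sum n x + 2 * (1 / 2) ^ b / D"
proof -
  define y where "y k = (tau ^^ k) x" for k
  define M where "M = level (real n)"
  have M: "1 \<le> M" unfolding M_def using n by (rule level_ge_1)
  define V where "V = {k. k < n \<and> y k < 1 / M}"
  \<comment> \<open>Start of the run. If \<open>V\<close> is empty the value is arbitrary, but it is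
    then only used in sums over the empty set \<open>V - B\<close>.\<close>
  define k0 where "k0 = (LEAST k. k \<in> V)"
  define B where "B = {k0..<k0 + b} \<inter> {..<n}"
  have ypos: "0 < y k" for k using pos by (simp add: y_def)
  have "(\<Sum>i<n. (1 / 2) ^ i) \<le> (2::real)"
    using sum_le_suminf[OF summable_geometric, of "1/2::real" "{..<n}"] by (simp add: suminf_geometric)
  then have geo: "(1 / 2) ^ b / D * (\<Sum>i<n. (1 / 2) ^ i) \<le> (1 / 2) ^ b / D * 2"
    using D(1) by (intro mult_left_mono) auto
  have "card B \<le> card {k0..<k0 + b}" unfolding B_def by (intro card_mono) auto
  then have "real_trimmed_sum n b x \<le> (\<Sum>k\<in>{..<n} - B. real_of_int \<lfloor>1 / y k\<rfloor>)"
    unfolding real_trimmed_sum_def y_def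
    using pos[THEN less_imp_le] by (intro sum_list_drop_rev_sort_le) (auto simp: B_def)
  \<comment> \<open>Below the level the cap is exact. Above it the whole of \<open>1 / y k\<close>
    is added on top of the cap, a harmless overcount.\<close>
  also have "\<dots> \<le> (\<Sum>k\<in>{..<n} - B. cap M (y k) + (if k \<in> V then 1 / y k else 0))"
  proof (rule sum_mono)
    fix k assume k: "k \<in> {..<n} - B"
    have fl: "real_of_int \<lfloor>1 / y k\<rfloor> \<le> 1 / y k" by simp
    show "real_of_int \<lfloor>1 / y k\<rfloor> \<le> cap M (y k) + (if k \<in> V then 1 / y k else 0)"
    proof (cases "k \<in> V")
      case True
      moreover have "real_of_int \<lfloor>1 / y k\<rfloor> \<le> cap M (y k) + 1 / y k"
        using fl M cap_nonneg[of M "y k"] by linarith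
      ultimately show ?thesis by simp
    next
      case False
      then have "1 / M \<le> y k" using k by (simp add: V_def)
      then have "cap M (y k) = 1 / y k" by (simp add: cap_def max_def)
      then show ?thesis using fl False by simp
    qed
  qed
  also have "\<dots> = (\<Sum>k\<in>{..<n} - B. cap M (y k)) + (\<Sum>k\<in>{..<n} - B. if k \<in> V then 1 / y k else 0)"
    by (rule sum.distrib)
  also have "(\<Sum>k\<in>{..<n} - B. cap M (y k)) \<le> (\<Sum>k<n. cap M (y k))"
    using M by (intro sum_mono2) (auto intro: cap_nonneg)
  also have "(\<Sum>k<n. cap M (y k)) = capped_sum n x"
    by (simp add: capped_sum_def M_def y_def)
  also have "(\<Sum>k\<in>{..<n} - B. if k \<in> V then 1 / y k else 0) = (\<Sum>k\<in>V - B. 1 / y k)"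
    by (intro sum.mono_neutral_cong_right) (auto simp: V_def)
  also have "\<dots> \<le> (\<Sum>k\<in>V - B. (1 / 2) ^ (k - k0) / D)"
  proof (rule sum_mono)
    fix k assume k: "k \<in> V - B"
    then have V: "k0 \<in> V" "k0 \<le> k" unfolding k0_def by (auto intro: LeastI Least_le)
    define d where "d = k - k0"
    have kd: "k = d + k0" using V by (simp add: d_def)
    \<comment> \<open>As long as this product stays below 1 the orbit doubles without wrapping;
      otherwise \<open>k0\<close> and \<open>k\<close> would be two separate visits.\<close>
    have run: "2 ^ d * y k0 < 1"
    proof (rule ccontr)
      assume "\<not> 2 ^ d * y k0 < 1"
      moreover have "d < n" "k0 < n" using V k by (auto simp: V_def d_def)
      moreover have "y k0 < 1 / M" "y (d + k0) < 1 / M" using V k kd by (auto simp: V_def)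
      ultimately have "two_visits n (1 / level n) x"
        unfolding two_visits_def y_def M_def
        by (intro exI[of _ k0] conjI exI[of _ d]) auto
      then show False using single by simp
    qed
    have "y k = (tau ^^ d) (y k0)" by (simp add: y_def kd funpow_add)
    also have "\<dots> = frac (2 ^ d * y k0)" using tau_funpow_range[OF x, of k0] by (simp add: tau_funpow y_def)
    also have "\<dots> = 2 ^ d * y k0" using run ypos[of k0] by (simp add: frac_eq)
    finally have yk: "y k = 2 ^ d * y k0" .
    have "2 ^ d * D \<le> y k" unfolding yk using D(2)[of k0] V by (simp add: V_def y_def)
    then have "1 / y k \<le> 1 / (2 ^ d * D)" using D(1) ypos by (intro divide_left_mono) auto
    then show "1 / y k \<le> (1 / 2) ^ (k - k0) / D" by (simp add: d_def power_one_over)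
  qed
  \<comment> \<open>Removing \<open>B\<close> leaves only offsets of at least \<open>b\<close> from
    the start of the run, and this produces the factor \<open>(1 / 2) ^ b\<close>.\<close>
  also have "\<dots> \<le> (\<Sum>k\<in>{k0 + b..<k0 + b + n}. (1 / 2) ^ (k - k0) / D)"
  proof (rule sum_mono2)
    show "V - B \<subseteq> {k0 + b..<k0 + b + n}"
    proof
      fix k assume k: "k \<in> V - B"
      then have "k0 \<le> k" unfolding k0_def by (auto intro: Least_le)
      then show "k \<in> {k0 + b..<k0 + b + n}" using k by (auto simp: B_def V_def)
    qed
  qed (use D in auto)
  also have "\<dots> = (\<Sum>i<n. (1 / 2) ^ b / D * (1 / 2) ^ i)"
    by (rule sum.reindex_bij_witness[of _ "\<lambda>i. k0 + b + i" "\<lambda>k. k - k0 - b"]) (auto simp: power_add[symmetric])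
  also have "\<dots> = (1 / 2) ^ b / D * (\<Sum>i<n. (1 / 2) ^ i)"
    by (rule sum_distrib_left[symmetric])
  also note geo
  finally show ?thesis by (simp add: mult.commute)
qed

section \<open>From bounds on one orbit to the limit\<close>

lemma two_power_bseq:
  assumes "0 < \<psi> (nat \<lfloor>ln (real n)\<rfloor>)" "0 < ln (real n)"
  shows "(1 / 2) ^ nat (bseq \<psi> n) \<le> 2 * ln (real n) / \<psi> (nat \<lfloor>ln (real n)\<rfloor>)"
proof -
  let ?p = "\<psi> (nat \<lfloor>ln (real n)\<rfloor>)" and ?L = "ln (real n)"
  have "ln (?p / ?L) / ln 2 - 1 \<le> bseq \<psi> n"
    unfolding bseq_def using assms by (simp add: ln_div)
  \<comment> \<open>If \<open>bseq\<close> is negative, \<open>nat\<close> replaces it by 0, which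
    only raises the exponent.\<close>
  also have "\<dots> \<le> real (nat (bseq \<psi> n))" by linarith
  finally have "2 powr (log 2 (?p / ?L) - 1) \<le> 2 powr real (nat (bseq \<psi> n))"
    by (intro powr_mono) (auto simp: log_def)
  also have "2 powr (log 2 (?p / ?L) - 1) = ?p / ?L / 2"
    using assms by (simp add: powr_diff)
  finally have "?p / (2 * ?L) \<le> 2 ^ nat (bseq \<psi> n)" by (simp add: powr_realpow mult.commute)
  then have "1 / 2 ^ nat (bseq \<psi> n) \<le> 1 / (?p / (2 * ?L))"
    using assms by (intro divide_left_mono mult_pos_pos) auto
  then show ?thesis by (simp add: power_one_over)
qed

text \<open>All probabilistic input enters as hypotheses on a single orbit, so the argument is
  deterministic from here on.\<close>

lemma trimmed_sum_tendsto:
  fixes \<psi> :: "nat \<Rightarrow> real"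
  assumes \<psi>: "\<psi> \<in> Psi"
    and b: "(\<lambda>n. real_of_int (bseq \<psi> n) / (ln (real n)) powr (1/4)) \<longlonglongrightarrow> 0"
    and x: "x \<in> {0..<1}" and pos: "\<And>k. 0 < (tau ^^ k) x"
    and slln: "(\<lambda>n. capped_sum (real n) x / (real n * ln (real n))) \<longlonglongrightarrow> 1"
    and single: "\<forall>\<^sub>F n in sequentially. \<not> two_visits n (1 / level (real n)) x"
    and far: "\<And>m. \<forall>\<^sub>F n in sequentially. \<forall>k<n. real (Suc m) / (real n * \<psi> (nat \<lfloor>ln (real n)\<rfloor>)) \<le> (tau ^^ k) x"
  shows "(\<lambda>n. real_trimmed_sum n (nat (bseq \<psi> n)) x / (real n * ln (real n))) \<longlonglongrightarrow> 1"
proof (rule tendstoI)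
  fix \<epsilon> :: real assume \<epsilon>: "0 < \<epsilon>"
  let ?S = "\<lambda>n. real_trimmed_sum n (nat (bseq \<psi> n)) x"
  let ?T = "\<lambda>n. capped_sum (real n) x"
  let ?r = "\<lambda>n::nat. real n * ln (real n)"
  \<comment> \<open>The run will contribute at most \<open>4 / real (Suc m)\<close> times the
    normaliser, so this choice keeps it below \<open>\<epsilon> / 2\<close>.\<close>
  obtain m :: nat where m: "8 / \<epsilon> < real (Suc m)" 
    using reals_Archimedean2[of "8 / \<epsilon>"] by (metis less_Suc_eq less_trans of_nat_less_iff)
  then have m': "4 / real (Suc m) < \<epsilon> / 2" using \<epsilon> by (simp add: field_simps)
  \<comment> \<open>Lower bound after division by the normaliser: the capped sum, minus the rounding
    loss, minus the loss from trimming.\<close>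
  define lo where "lo n = ?T n / ?r n - 1 / ln (real n) - \<bar>real_of_int (bseq \<psi> n) / ln (real n) powr (1/4)\<bar>" for n
  have "(\<lambda>n::nat. 1 / ln (real n)) \<longlonglongrightarrow> 0" by real_asymp
  from tendsto_diff[OF tendsto_diff[OF slln this] tendsto_rabs[OF b]]
  have "lo \<longlonglongrightarrow> 1" by (simp add: lo_def[abs_def])
  then have "\<forall>\<^sub>F n in sequentially. 1 - \<epsilon> < lo n" using \<epsilon> by (intro order_tendstoD) auto
  moreover have "\<forall>\<^sub>F n in sequentially. ?T n / ?r n < 1 + \<epsilon> / 2"
    using slln \<epsilon> by (intro order_tendstoD) auto
  ultimately show "\<forall>\<^sub>F n in sequentially. dist (?S n / ?r n) 1 < \<epsilon>"
    using single far[of m] eventually_ge_exp_1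
  proof eventually_elim
    case (elim n)
    define L where "L = ln (real n)"
    define p where "p = \<psi> (nat \<lfloor>L\<rfloor>)"
    define c where "c = nat (bseq \<psi> n)"
    have L: "1 \<le> L" unfolding L_def using elim(5) by (rule ln_ge_1)
    have n0: "0 < real n" using one_le_of_exp_1_le[OF elim(5)] by simp
    \<comment> \<open>\<open>Psi\<close> grants positivity only from argument 1 on.\<close>
    have "1 \<le> nat \<lfloor>L\<rfloor>" using L by (simp add: le_nat_iff le_floor_iff)
    then have p: "0 < p" using \<psi> by (simp add: Psi_def p_def)
    define D where "D = real (Suc m) / (real n * p)"
    have "?S n \<le> ?T n + 2 * (1 / 2) ^ c / D"
      unfolding c_def using elim(3,4,5) p n0
      by (intro real_trimmed_sum_le x pos) (auto simp: D_def p_def L_def simp del: of_nat_Suc)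
    also have "2 * (1 / 2) ^ c / D \<le> 2 * (2 * L / p) / D"
      unfolding c_def using L p n0
      by (intro divide_right_mono mult_left_mono two_power_bseq[of \<psi> n, folded L_def, folded p_def])
        (auto simp: D_def)
    \<comment> \<open>The factor \<open>p\<close> in \<open>D\<close> cancels the one from the power
      of 2; this is the purpose of the definition of \<open>bseq\<close>.\<close>
    also have "\<dots> = 4 / real (Suc m) * (real n * L)"
      using p n0 by (simp add: D_def field_simps)
    also have "\<dots> \<le> \<epsilon> / 2 * (real n * L)"
      using m' L n0 by (intro mult_right_mono) auto
    finally have "?S n / ?r n \<le> (?T n + \<epsilon> / 2 * (real n * L)) / ?r n"
      using L n0 by (intro divide_right_mono) (auto simp: L_def)
    also have "\<dots> = ?T n / ?r n + \<epsilon> / 2"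
      using L n0 by (simp add: L_def[symmetric] add_divide_distrib)
    finally have up: "?S n / ?r n < 1 + \<epsilon>" using elim(2) by linarith
    have "(?T n - n - c * level n) / ?r n \<le> ?S n / ?r n"
      unfolding c_def using elim(5) pos L n0 
      by (intro divide_right_mono real_trimmed_sum_ge) (auto simp: L_def)
    also have "(?T n - n - c * level n) / ?r n = ?T n / ?r n - 1 / L - c * (L powr (3/4) / L)"
      using L n0 by (simp add: L_def[symmetric] level_def diff_divide_distrib)
    \<comment> \<open>The level has exponent 3/4 and the normaliser 1, so the trimming loss is
      measured by the very quotient assumed to vanish.\<close>
    also have "L powr (3/4) / L = L powr (- (1/4))"
      using L powr_diff[of L "3/4" 1] by simp
    also have "\<dots> = 1 / L powr (1/4)" by (rule powr_minus_divide)
    finally have "?T n / ?r n - 1 / L - c * (1 / L powr (1/4)) \<le> ?S n / ?r n" .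
    moreover have "c * (1 / L powr (1/4)) \<le> \<bar>real_of_int (bseq \<psi> n) / L powr (1/4)\<bar>"
    proof -
      have "real c \<le> \<bar>real_of_int (bseq \<psi> n)\<bar>" unfolding c_def by linarith
      then show ?thesis by (simp add: divide_right_mono)
    qed
    ultimately have "lo n \<le> ?S n / ?r n" unfolding lo_def L_def by linarith
    then show ?case using up elim(1) by (simp add: dist_real_def abs_less_iff)
  qed
qed

theorem theorem1p1:
  fixes \<psi> :: "nat \<Rightarrow> real"
  assumes "\<psi> \<in> Psi"
    and "(\<lambda>n. real_of_int (bseq \<psi> n) / (ln (real n)) powr (1/4)) \<longlonglongrightarrow> 0"
  shows "AE x in lborel. x \<in> {0..<1} \<longrightarrow>
           (\<lambda>n. trimmed_sum n (nat (bseq \<psi> n)) x / ereal (real n * ln (real n))) \<longlonglongrightarrow> 1"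
proof -
  \<comment> \<open>Thresholds are indexed by naturals so that a single null set serves all of
    them.\<close>
  have "AE x in unif. \<forall>m. \<forall>\<^sub>F n in sequentially. \<forall>k<n.
      real (Suc m) / (real n * \<psi> (nat \<lfloor>ln (real n)\<rfloor>)) \<le> (tau ^^ k) x"
    using assms(1) by (subst AE_all_countable) (auto intro: AE_eventually_tau_ge simp del: of_nat_Suc)
  then have "AE x in unif. (\<lambda>n. trimmed_sum n (nat (bseq \<psi> n)) x / ereal (real n * ln (real n))) \<longlonglongrightarrow> 1"
    using AE_tau_pos capped_sum_strong_law AE_eventually_not_two_visits AE_space
  proof eventually_elim
    case (elim x)
    have "(\<lambda>n. real_trimmed_sum n (nat (bseq \<psi> n)) x / (real n * ln (real n))) \<longlonglongrightarrow> 1"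
      using elim by (intro trimmed_sum_tendsto assms) auto
    then have "(\<lambda>n. ereal (real_trimmed_sum n (nat (bseq \<psi> n)) x / (real n * ln (real n)))) \<longlonglongrightarrow> 1"
      by (simp add: one_ereal_def)
    moreover have "\<forall>\<^sub>F n in sequentially. ereal (real_trimmed_sum n (nat (bseq \<psi> n)) x / (real n * ln (real n)))
        = trimmed_sum n (nat (bseq \<psi> n)) x / ereal (real n * ln (real n))"
      using eventually_ge_exp_1
    proof eventually_elim
      case (elim n)
      \<comment> \<open>Extended real division agrees with real division only for a nonzero divisor,
        hence the restriction to large \<open>n\<close>.\<close>
      have "real n * ln (real n) \<noteq> 0"
        using ln_ge_1[OF elim] one_le_of_exp_1_le[OF elim] by auto
      then show ?case
        using \<open>\<forall>k. 0 < (tau ^^ k) x\<close> by (simp only: trimmed_sum_eq_ereal ereal_divide if_False)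
    qed
    ultimately show ?case by (rule Lim_transform_eventually)
  qed
  then show ?thesis by (subst (asm) AE_restrict_space_iff) auto
qed

end
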